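(* Let $p(\rho)=\rho^2$. Consider any Riemann data $(\rho_\pm,v_{b\pm})$ with $\rho_\pm>0$, $v_{b-}>v_{b+}$ and $$S:=(v_{b-}-v_{b+})^2\rho_+\rho_--(\rho_+-\rho_-)(p(\rho_+)-p(\rho_-))>0,$$ so that the Riemann problem has a two shock solution, with intermediate density $\rho_m$. Let $I=[\rho^*,\rho_m]$ with $\max\{\rho_-,\rho_+\}<\rho^*<\rho_m$, and let the action be taken over any box adapted to $I$. Then: (1) For any $\epsilon_2>0$ and any $\rho_1\in[\rho^*,\rho_m)$, the action of the two shock solution is strictly lower than the action of every convex integration solution with parameters $(\rho_1,\epsilon_2)$. (2) Consequently none of these convex integration solutions is LAAP-admissible. (3) If there are no entropic weak solutions of the Riemann problem other than these convex integration solutions and the two shock solution, then the two shock solution is the unique LAAP-admissible solution.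
   Context: **Equations.** The barotropic compressible Euler system on $(t,\mathbf x)\in[0,\infty)\times\mathbb R^2$ is $\partial_t\rho+\mathrm{div}_{\mathbf x}(\rho\mathbf v)=0$, $\partial_t(\rho\mathbf v)+\mathrm{div}_{\mathbf x}(\rho\mathbf v\otimes\mathbf v)+\nabla_{\mathbf x}p(\rho)=0$, here with $p(\rho)=\rho^2$. Weak solutions are understood in the sense of distributions (including the initial data). The specific internal energy is $\epsilon(\rho)=\rho$ (so $\epsilon'(\rho)=p(\rho)/\rho^2$). A weak solution is *entropic* if $\partial_t(\tfrac12\rho|\mathbf v|^2+\rho\epsilon(\rho))+\mathrm{div}_{\mathbf x}[(\tfrac12\rho|\mathbf v|^2+\rho\epsilon(\rho)+p(\rho))\mathbf v]\le 0$ in the sense of distributions. **Riemann data.** Write $\mathbf v=(v_a,v_b)$. The initial data are $\rho=\rho_-$, $\mathbf v=(0,v_{b-})$ for $x_2<0$ and $\rho=\rho_+$, $\mathbf v=(0,v_{b+})$ for $x_2>0$. **Functions of $\rho_1$.** For $\rho_1>\max\{\rho_-,\rho_+\}$ let $\nu_-(\rho_1)<\nu_+(\rho_1)$, $\beta(\rho_1)$, $\epsilon_1(\rho_1)$ be the unique real numbers with $$\nu_\pm(\rho_\pm-\rho_1)=\rho_\pm v_{b\pm}-\rho_1\beta,$$ $$\nu_\pm(\rho_\pm v_{b\pm}-\rho_1\beta)=\rho_\pm v_{b\pm}^2+p(\rho_\pm)-\rho_1(\beta^2+\epsilon_1)-p(\rho_1)$$ (two equations for each sign). Explicitly, with $R=\rho_--\rho_+$,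 $A=\rho_-v_{b-}-\rho_+v_{b+}$: if $R\neq0$, $\nu_-=\frac AR-\frac1R\sqrt{S\,\frac{\rho_1-\rho_+}{\rho_1-\rho_-}}$ and $\nu_+=\frac AR-\frac1R\sqrt{S\,\frac{\rho_1-\rho_-}{\rho_1-\rho_+}}$; if $R=0$, $\nu_\pm=\frac{v_{b-}+v_{b+}}2\pm\frac{\rho_-(v_{b-}-v_{b+})}{2(\rho_1-\rho_-)}$. **Two shock solution.** $\rho_m>\max\{\rho_-,\rho_+\}$ is the intermediate density and $(0,v_m)$ the intermediate velocity: $\epsilon_1(\rho_m)=0$, $\beta(\rho_m)=v_m$. The two shock solution equals $(\rho_-,(0,v_{b-}))$ for $x_2<\nu_-(\rho_m)t$, $(\rho_m,(0,v_m))$ for $\nu_-(\rho_m)t<x_2<\nu_+(\rho_m)t$, and $(\rho_+,(0,v_{b+}))$ for $x_2>\nu_+(\rho_m)t$. It is an entropic weak solution. **Convex integration solutions.** Let $\max\{\rho_-,\rho_+\}<\rho_1<\rho_m$ with $\epsilon_1(\rho_1)>0$, let $\epsilon_2>0$, and put $C=\beta^2(\rho_1)+\epsilon_1(\rho_1)+\epsilon_2$, $\mathbf v_1=(0,\beta(\rho_1))$, and let $\mathbf u_1$ be the symmetric trace-free $2\times2$ matrix with $\mathbf v_1\otimes\mathbf v_1-\mathbf u_1=\frac C2\mathrm{Id}-\mathrm{diag}(\epsilon_2,\epsilon_1(\rho_1))$. Let $P_-=\{x_2<\nu_-(\rho_1)t\}$, $P_1=\{\nu_-(\rho_1)t<x_2<\nu_+(\rho_1)t\}$,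 $P_+=\{x_2>\nu_+(\rho_1)t\}$ ($t>0$). A convex integration solution with parameters $(\rho_1,\epsilon_2)$ is an entropic weak solution of the Riemann problem which equals $(\rho_\pm,(0,v_{b\pm}))$ in $P_\pm$, and in $P_1$ has density $\rho_1$ and velocity $\mathbf v_1+\mathbf v$, where $(\mathbf v,\mathbf u)$ vanishes outside $P_1$, $\mathrm{div}_{\mathbf x}\mathbf v=0$, $\partial_t\mathbf v+\mathrm{div}_{\mathbf x}\mathbf u=0$ in the sense of distributions, $\mathbf u$ is symmetric and trace-free, and $(\mathbf v_1+\mathbf v)\otimes(\mathbf v_1+\mathbf v)-(\mathbf u_1+\mathbf u)=\frac C2\mathrm{Id}$ a.e. in $P_1$; in particular $|\mathbf v_1+\mathbf v|^2=C$ a.e. in $P_1$. (These are the solutions constructed by Chiodaroli and Kreml; whenever the corresponding fan sub-solution satisfies the energy inequality across both interfaces, infinitely many exist.) **Action and LAAP.** The Lagrangian is $\mathcal L=\tfrac12\rho|\mathbf v|^2-\rho\epsilon(\rho)$ and the action is $\int_{-L_3}^{L_3}\int_0^T\int_{\ell_1}^{\ell_2}\mathcal L\,dx_2\,dt\,dx_1$. A box, given by $L_3>0$, $T>0$, $\ell_1<\ell_2$, is adapted to $I$ if $\ell_1<T\min_{I}\nu_-$ and $\ell_2>T\max_I\nu_+$. An entropic weak solution is LAAP-admissible (least action admissibility principle) if its action is less than or equal to the action of every other entropic weak solution with the same initial and boundary data. *)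

theory Defs
  imports "HOL-Analysis.Analysis"
begin

(* A space-time point is z = (t, x) with t = fst z and x = snd z in the plane.
   Fields are functions on all of space-time; only their restriction to t >= 0
   enters, and only up to null sets. *)
type_synonym spacetime = "real \<times> (real^2)"

definition slab :: "spacetime set" where
  "slab = {0..} \<times> UNIV"


section \<open>Test functions and balance laws in the sense of distributions\<close>

fun Ck :: "nat \<Rightarrow> ('a::euclidean_space \<Rightarrow> real) \<Rightarrow> bool" where
  "Ck 0 f \<longleftrightarrow> continuous_on UNIV f"
| "Ck (Suc k) f \<longleftrightarrow>
     (\<forall>x. f differentiable (at x)) \<and> (\<forall>h. Ck k (\<lambda>x. frechet_derivative f (at x) h))"

definition test_function :: "('a::euclidean_space \<Rightarrow> real) \<Rightarrow> bool" where
  "test_function \<phi> \<longleftrightarrow> (\<forall>k. Ck k \<phi>) \<and> compact (closure {z. \<phi> z \<noteq> 0})"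

definition dt :: "(spacetime \<Rightarrow> real) \<Rightarrow> spacetime \<Rightarrow> real" where
  "dt \<phi> z = frechet_derivative \<phi> (at z) (1, 0)"

definition grad :: "(spacetime \<Rightarrow> real) \<Rightarrow> spacetime \<Rightarrow> real^2" where
  "grad \<phi> z = (\<chi> i. frechet_derivative \<phi> (at z) (0, axis i 1))"

definition loc_integrable :: "(spacetime \<Rightarrow> 'b::{banach, second_countable_topology}) \<Rightarrow> bool" where
  "loc_integrable f \<longleftrightarrow> (\<forall>K. compact K \<and> K \<subseteq> slab \<longrightarrow> set_integrable lebesgue K f)"

(* The pairing of -(d/dt w + div F), with w = w0 at t = 0, with a test function.
   A test function on [0,oo) x R^2 is the restriction of one on R x R^2, so it need
   not vanish at t = 0; this is how the initial data enter. *)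
definition weak_pairing ::
  "(spacetime \<Rightarrow> real) \<Rightarrow> (spacetime \<Rightarrow> real^2) \<Rightarrow> (real^2 \<Rightarrow> real) \<Rightarrow> (spacetime \<Rightarrow> real) \<Rightarrow> real" where
  "weak_pairing w F w0 \<phi> =
     set_lebesgue_integral lebesgue slab (\<lambda>z. w z * dt \<phi> z + F z \<bullet> grad \<phi> z)
     + (LINT x|lebesgue. w0 x * \<phi> (0, x))"


section \<open>The barotropic Euler system with quadratic pressure\<close>

definition pressure :: "real \<Rightarrow> real" where
  "pressure r = r\<^sup>2"

definition internal_energy :: "real \<Rightarrow> real" where
  "internal_energy r = r"

definition total_energy :: "real \<Rightarrow> real^2 \<Rightarrow> real" where
  "total_energy r w = r * (norm w)\<^sup>2 / 2 + r * internal_energy r"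

definition energy_flux :: "real \<Rightarrow> real^2 \<Rightarrow> real^2" where
  "energy_flux r w = (total_energy r w + pressure r) *\<^sub>R w"

(* i-th row of r (w \<otimes> w) + p(r) Id *)
definition momentum_flux :: "2 \<Rightarrow> real \<Rightarrow> real^2 \<Rightarrow> real^2" where
  "momentum_flux i r w = (r * w $ i) *\<^sub>R w + pressure r *\<^sub>R axis i 1"

definition weak_solution ::
  "(real^2 \<Rightarrow> real) \<Rightarrow> (real^2 \<Rightarrow> real^2) \<Rightarrow> (spacetime \<Rightarrow> real) \<Rightarrow> (spacetime \<Rightarrow> real^2) \<Rightarrow> bool" where
  "weak_solution \<rho>0 v0 \<rho> v \<longleftrightarrow>
     \<rho> \<in> borel_measurable (lebesgue_on slab) \<and>
     v \<in> borel_measurable (lebesgue_on slab) \<and>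
     (AE z in lebesgue. z \<in> slab \<longrightarrow> 0 \<le> \<rho> z) \<and>
     loc_integrable \<rho> \<and>
     loc_integrable (\<lambda>z. \<rho> z *\<^sub>R v z) \<and>
     (\<forall>i. loc_integrable (\<lambda>z. momentum_flux i (\<rho> z) (v z))) \<and>
     (\<forall>\<phi>. test_function \<phi> \<longrightarrow> weak_pairing \<rho> (\<lambda>z. \<rho> z *\<^sub>R v z) \<rho>0 \<phi> = 0) \<and>
     (\<forall>i \<phi>. test_function \<phi> \<longrightarrow>
        weak_pairing (\<lambda>z. \<rho> z * v z $ i) (\<lambda>z. momentum_flux i (\<rho> z) (v z))
          (\<lambda>x. \<rho>0 x * v0 x $ i) \<phi> = 0)"

definition entropic_weak_solution ::
  "(real^2 \<Rightarrow> real) \<Rightarrow> (real^2 \<Rightarrow> real^2) \<Rightarrow> (spacetime \<Rightarrow> real) \<Rightarrow> (spacetime \<Rightarrow> real^2) \<Rightarrow> bool" where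
  "entropic_weak_solution \<rho>0 v0 \<rho> v \<longleftrightarrow>
     weak_solution \<rho>0 v0 \<rho> v \<and>
     loc_integrable (\<lambda>z. total_energy (\<rho> z) (v z)) \<and>
     loc_integrable (\<lambda>z. energy_flux (\<rho> z) (v z)) \<and>
     (\<forall>\<phi>. test_function \<phi> \<and> (\<forall>z. 0 \<le> \<phi> z) \<longrightarrow>
        weak_pairing (\<lambda>z. total_energy (\<rho> z) (v z)) (\<lambda>z. energy_flux (\<rho> z) (v z))
          (\<lambda>x. total_energy (\<rho>0 x) (v0 x)) \<phi> \<ge> 0)"

definition same_solution ::
  "(spacetime \<Rightarrow> real) \<Rightarrow> (spacetime \<Rightarrow> real^2) \<Rightarrow> (spacetime \<Rightarrow> real) \<Rightarrow> (spacetime \<Rightarrow> real^2) \<Rightarrow> bool" where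
  "same_solution \<rho> v \<rho>' v' \<longleftrightarrow> (AE z in lebesgue. z \<in> slab \<longrightarrow> \<rho> z = \<rho>' z \<and> v z = v' z)"


section \<open>Riemann data, fan parameters and the two shock solution\<close>

(* The velocity data are (0, vb_minus) below and (0, vb_plus) above the line x2 = 0. *)
record riemann_data =
  rho_minus :: real
  rho_plus :: real
  vb_minus :: real
  vb_plus :: real

definition rho_init :: "riemann_data \<Rightarrow> real^2 \<Rightarrow> real" where
  "rho_init d x = (if x $ 2 < 0 then rho_minus d else rho_plus d)"

definition v_init :: "riemann_data \<Rightarrow> real^2 \<Rightarrow> real^2" where
  "v_init d x = (if x $ 2 < 0 then vector [0, vb_minus d] else vector [0, vb_plus d])"

definition rho_max :: "riemann_data \<Rightarrow> real" where
  "rho_max d = max (rho_minus d) (rho_plus d)"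

definition S_data :: "riemann_data \<Rightarrow> real" where
  "S_data d = (vb_minus d - vb_plus d)\<^sup>2 * rho_plus d * rho_minus d
     - (rho_plus d - rho_minus d) * (pressure (rho_plus d) - pressure (rho_minus d))"

definition fan_equations :: "riemann_data \<Rightarrow> real \<Rightarrow> real \<Rightarrow> real \<Rightarrow> real \<Rightarrow> real \<Rightarrow> bool" where
  "fan_equations d \<rho>1 nm np b e \<longleftrightarrow>
     nm < np \<and>
     nm * (rho_minus d - \<rho>1) = rho_minus d * vb_minus d - \<rho>1 * b \<and>
     np * (rho_plus d - \<rho>1) = rho_plus d * vb_plus d - \<rho>1 * b \<and>
     nm * (rho_minus d * vb_minus d - \<rho>1 * b) =
       rho_minus d * (vb_minus d)\<^sup>2 + pressure (rho_minus d) - \<rho>1 * (b\<^sup>2 + e) - pressure \<rho>1 \<and>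
     np * (rho_plus d * vb_plus d - \<rho>1 * b) =
       rho_plus d * (vb_plus d)\<^sup>2 + pressure (rho_plus d) - \<rho>1 * (b\<^sup>2 + e) - pressure \<rho>1"

(* The system above has exactly one solution when the densities are positive,
   vb_minus > vb_plus, S_data > 0 and \<rho>1 > rho_max; only then are the following
   four functions meaningful. *)
definition nu_minus :: "riemann_data \<Rightarrow> real \<Rightarrow> real" where
  "nu_minus d \<rho>1 = (THE nm. \<exists>np b e. fan_equations d \<rho>1 nm np b e)"

definition nu_plus :: "riemann_data \<Rightarrow> real \<Rightarrow> real" where
  "nu_plus d \<rho>1 = (THE np. \<exists>nm b e. fan_equations d \<rho>1 nm np b e)"

definition beta :: "riemann_data \<Rightarrow> real \<Rightarrow> real" where
  "beta d \<rho>1 = (THE b. \<exists>nm np e. fan_equations d \<rho>1 nm np b e)"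

definition eps1 :: "riemann_data \<Rightarrow> real \<Rightarrow> real" where
  "eps1 d \<rho>1 = (THE e. \<exists>nm np b. fan_equations d \<rho>1 nm np b e)"

definition is_intermediate_density :: "riemann_data \<Rightarrow> real \<Rightarrow> bool" where
  "is_intermediate_density d r \<longleftrightarrow> rho_max d < r \<and> eps1 d r = 0"

definition rho_m :: "riemann_data \<Rightarrow> real" where
  "rho_m d = (THE r. is_intermediate_density d r)"

definition v_m :: "riemann_data \<Rightarrow> real" where
  "v_m d = beta d (rho_m d)"

definition P_minus :: "riemann_data \<Rightarrow> real \<Rightarrow> spacetime set" where
  "P_minus d \<rho>1 = {(t, x). 0 < t \<and> x $ 2 < nu_minus d \<rho>1 * t}"

definition P_1 :: "riemann_data \<Rightarrow> real \<Rightarrow> spacetime set" where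
  "P_1 d \<rho>1 = {(t, x). 0 < t \<and> nu_minus d \<rho>1 * t < x $ 2 \<and> x $ 2 < nu_plus d \<rho>1 * t}"

definition P_plus :: "riemann_data \<Rightarrow> real \<Rightarrow> spacetime set" where
  "P_plus d \<rho>1 = {(t, x). 0 < t \<and> nu_plus d \<rho>1 * t < x $ 2}"

definition two_shock_rho :: "riemann_data \<Rightarrow> spacetime \<Rightarrow> real" where
  "two_shock_rho d z =
     (if z \<in> P_minus d (rho_m d) then rho_minus d
      else if z \<in> P_1 d (rho_m d) then rho_m d
      else rho_plus d)"

definition two_shock_v :: "riemann_data \<Rightarrow> spacetime \<Rightarrow> real^2" where
  "two_shock_v d z =
     (if z \<in> P_minus d (rho_m d) then vector [0, vb_minus d]
      else if z \<in> P_1 d (rho_m d) then vector [0, v_m d]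
      else vector [0, vb_plus d])"


section \<open>Convex integration solutions\<close>

definition outer :: "real^2 \<Rightarrow> real^2 \<Rightarrow> real^2^2" where
  "outer a b = (\<chi> i j. a $ i * b $ j)"

definition diag2 :: "real \<Rightarrow> real \<Rightarrow> real^2^2" where
  "diag2 a b = vector [vector [a, 0], vector [0, b]]"

definition C_fan :: "riemann_data \<Rightarrow> real \<Rightarrow> real \<Rightarrow> real" where
  "C_fan d \<rho>1 \<epsilon>2 = (beta d \<rho>1)\<^sup>2 + eps1 d \<rho>1 + \<epsilon>2"

definition v1_fan :: "riemann_data \<Rightarrow> real \<Rightarrow> real^2" where
  "v1_fan d \<rho>1 = vector [0, beta d \<rho>1]"

(* Solves v1 \<otimes> v1 - u1 = (C/2) Id - diag(\<epsilon>2, \<epsilon>1); symmetric and trace-free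
   by the choice of C. *)
definition u1_fan :: "riemann_data \<Rightarrow> real \<Rightarrow> real \<Rightarrow> real^2^2" where
  "u1_fan d \<rho>1 \<epsilon>2 =
     outer (v1_fan d \<rho>1) (v1_fan d \<rho>1) - (mat (C_fan d \<rho>1 \<epsilon>2 / 2) - diag2 \<epsilon>2 (eps1 d \<rho>1))"

definition convex_integration_solution ::
  "riemann_data \<Rightarrow> real \<Rightarrow> real \<Rightarrow> (spacetime \<Rightarrow> real) \<Rightarrow> (spacetime \<Rightarrow> real^2) \<Rightarrow> bool" where
  "convex_integration_solution d \<rho>1 \<epsilon>2 \<rho> v \<longleftrightarrow>
     rho_max d < \<rho>1 \<and> \<rho>1 < rho_m d \<and> 0 < eps1 d \<rho>1 \<and> 0 < \<epsilon>2 \<and>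
     entropic_weak_solution (rho_init d) (v_init d) \<rho> v \<and>
     (AE z in lebesgue. z \<in> P_minus d \<rho>1 \<longrightarrow> \<rho> z = rho_minus d \<and> v z = vector [0, vb_minus d]) \<and>
     (AE z in lebesgue. z \<in> P_plus d \<rho>1 \<longrightarrow> \<rho> z = rho_plus d \<and> v z = vector [0, vb_plus d]) \<and>
     (\<exists>(w :: spacetime \<Rightarrow> real^2) (u :: spacetime \<Rightarrow> real^2^2).
        loc_integrable w \<and> loc_integrable u \<and>
        (AE z in lebesgue. z \<notin> P_1 d \<rho>1 \<longrightarrow> w z = 0 \<and> u z = 0) \<and>
        (AE z in lebesgue. transpose (u z) = u z \<and> trace (u z) = 0) \<and>
        (\<forall>\<phi>. test_function \<phi> \<longrightarrow> (LINT z|lebesgue. w z \<bullet> grad \<phi> z) = 0) \<and>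
        (\<forall>i \<phi>. test_function \<phi> \<longrightarrow>
           (LINT z|lebesgue. w z $ i * dt \<phi> z + u z $ i \<bullet> grad \<phi> z) = 0) \<and>
        (AE z in lebesgue. z \<in> P_1 d \<rho>1 \<longrightarrow> \<rho> z = \<rho>1 \<and> v z = v1_fan d \<rho>1 + w z) \<and>
        (AE z in lebesgue. z \<in> P_1 d \<rho>1 \<longrightarrow>
           outer (v1_fan d \<rho>1 + w z) (v1_fan d \<rho>1 + w z) - (u1_fan d \<rho>1 \<epsilon>2 + u z)
             = mat (C_fan d \<rho>1 \<epsilon>2 / 2)))"


section \<open>Action and least action admissibility\<close>

definition lagrangian :: "real \<Rightarrow> real^2 \<Rightarrow> real" where
  "lagrangian r w = r * (norm w)\<^sup>2 / 2 - r * internal_energy r"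

definition action ::
  "real \<Rightarrow> real \<Rightarrow> real \<Rightarrow> real \<Rightarrow> (spacetime \<Rightarrow> real) \<Rightarrow> (spacetime \<Rightarrow> real^2) \<Rightarrow> real" where
  "action L3 T l1 l2 \<rho> v =
     set_lebesgue_integral lebesgue
       {(t, x). t \<in> {0..T} \<and> x $ 1 \<in> {-L3..L3} \<and> x $ 2 \<in> {l1..l2}}
       (\<lambda>z. lagrangian (\<rho> z) (v z))"

(* nu_minus and nu_plus are continuous above rho_max, so for a compact interval I
   the infimum and supremum are a minimum and a maximum. *)
definition adapted_box :: "riemann_data \<Rightarrow> real set \<Rightarrow> real \<Rightarrow> real \<Rightarrow> real \<Rightarrow> real \<Rightarrow> bool" where
  "adapted_box d I L3 T l1 l2 \<longleftrightarrow>
     0 < L3 \<and> 0 < T \<and> l1 < l2 \<and>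
     l1 < T * (INF r\<in>I. nu_minus d r) \<and> T * (SUP r\<in>I. nu_plus d r) < l2"

(* The problem is posed on the whole plane, so boundary data are the far-field values
   as x2 tends to -oo and +oo, on the time interval of the box. *)
definition same_boundary_data ::
  "real \<Rightarrow> (spacetime \<Rightarrow> real) \<Rightarrow> (spacetime \<Rightarrow> real^2) \<Rightarrow> (spacetime \<Rightarrow> real) \<Rightarrow> (spacetime \<Rightarrow> real^2) \<Rightarrow> bool" where
  "same_boundary_data T \<rho> v \<rho>' v' \<longleftrightarrow>
     (\<exists>M. AE z in lebesgue. fst z \<in> {0..T} \<and> M \<le> \<bar>snd z $ 2\<bar> \<longrightarrow> \<rho> z = \<rho>' z \<and> v z = v' z)"

definition laap_admissible ::
  "real \<Rightarrow> real \<Rightarrow> real \<Rightarrow> real \<Rightarrow> (real^2 \<Rightarrow> real) \<Rightarrow> (real^2 \<Rightarrow> real^2) \<Rightarrow>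
   (spacetime \<Rightarrow> real) \<Rightarrow> (spacetime \<Rightarrow> real^2) \<Rightarrow> bool" where
  "laap_admissible L3 T l1 l2 \<rho>0 v0 \<rho> v \<longleftrightarrow>
     entropic_weak_solution \<rho>0 v0 \<rho> v \<and>
     (\<forall>\<rho>' v'. entropic_weak_solution \<rho>0 v0 \<rho>' v' \<and> same_boundary_data T \<rho> v \<rho>' v' \<longrightarrow>
        action L3 T l1 l2 \<rho> v \<le> action L3 T l1 l2 \<rho>' v')"

end

theory Submission
  imports Defs
begin

text \<open>The fan equations say that the wave speeds \<open>\<nu>\<^sub>\<plusminus>\<close> make the density profile of every fan share
  its zeroth, first and second compensated moments in \<open>x\<^sub>2\<close> with all the others. As \<open>\<rho>\<^sub>1\<close> grows the
  wedges are nested and shrink, so the profile gets more concentrated. Twice the Lagrangian is the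
  \<open>x\<^sub>2\<close>-momentum flux minus three times the pressure: the flux part amounts to the third jump moment
  \<open>\<Sum> [\<rho>] \<nu>\<^sup>3\<close>, which decreases with \<open>\<rho>\<^sub>1\<close>, while the pressure part \<open>\<integral> \<rho>\<^sup>2\<close> increases by convexity.
  The parameter \<open>\<epsilon>\<^sub>2\<close> only adds a nonnegative multiple of the volume of the wedge.

  An adapted box need not meet the line \<open>x\<^sub>2 = 0\<close>. If it does not, it cuts off the tip of the wedge, and
  a speed \<open>\<nu>\<close> enters the volumes through \<open>\<nu> + k / \<nu>\<close> instead of \<open>\<nu>\<close>; the additional terms are inverse
  moments of the profile, which have the right monotonicity as well.

  That the two shock solution is entropic reduces to the Rankine-Hugoniot conditions, because the weak
  pairing of a piecewise constant field is a combination of integrals of the test function along the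
  two shocks.\<close>

section \<open>Wave speeds of the fan\<close>

text \<open>A fan with middle density \<open>r\<close> is encoded by
  \<open>P = r - rho_minus\<close>, \<open>R = r - rho_plus\<close> and its speeds
  \<open>m < n\<close>. Subtracting the upper from the lower fan equations eliminates
  \<open>\<beta>\<close> and \<open>e\<close> and leaves \<open>R n - P m = A\<close>,
  \<open>R n^2 - P m^2 = B\<close>, where \<open>A\<close>, \<open>B\<close> and
  \<open>J = R - P\<close> depend on the data only. Comparing fans through these three invariants,
  and not through the square roots in the explicit speeds, treats equal and unequal densities alike
  and reduces each comparison to one polynomial identity. Behind the identities stands a convexity
  argument: the difference of two nested profiles is negative, positive, negative from left to right
  and orthogonal to affine functions, so it has a sign against convex weights.

  A cut tip might be expected to disturb the flux part as well. But there
  \<open>\<nu> + k / \<nu>\<close> is multiplied by \<open>\<nu>^2\<close>, so the cut contributes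
  only \<open>k * A\<close>, the same for all fans; just the pressure part needs the inverse
  moments.\<close>

lemma speeds_quadratic:
  fixes P R A B m n :: real
  assumes "R * n - P * m = A" "R * n\<^sup>2 - P * m\<^sup>2 = B"
  shows "P * R * (n - m)\<^sup>2 = A\<^sup>2 - (R - P) * B"
    and "(R - P) * m\<^sup>2 - 2 * A * m + B = R * (n - m)\<^sup>2"
    and "(R - P) * n\<^sup>2 - 2 * A * n + B = - P * (n - m)\<^sup>2"
    and "(R - P) * m - A = - R * (n - m)"
    and "(R - P) * n - A = - P * (n - m)"
  unfolding assms[symmetric] by algebra+

text \<open>Both speeds lie on the half-line where the quadratic \<open>q z = J z\<^sup>2 - 2 A z + B\<close> decreases,
  and \<open>q m = S / P\<close>, \<open>q n = - S / R\<close> for \<open>S = A\<^sup>2 - J B\<close>.\<close>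

lemma speeds_mono:
  fixes P R P' R' A B m n m' n' :: real
  assumes pos: "0 < P" "0 < R" and le: "P \<le> P'" and J: "R - P = R' - P'"
    and mn: "m < n" and mn': "m' < n'"
    and e: "R * n - P * m = A" "R * n\<^sup>2 - P * m\<^sup>2 = B"
    and e': "R' * n' - P' * m' = A" "R' * n'\<^sup>2 - P' * m'\<^sup>2 = B"
  shows "m \<le> m'" "n' \<le> n"
proof -
  note q = speeds_quadratic[OF e] and q' = speeds_quadratic[OF e', folded J]
  have pos': "0 < P'" "0 < R'" using pos le J by linarith+
  have RR: "R \<le> R'" using J le by linarith
  define S where "S = A\<^sup>2 - (R - P) * B"
  have S: "P * (R * (n - m)\<^sup>2) = S" "P' * (R' * (n' - m')\<^sup>2) = S"
    using q(1) q'(1) by (auto simp: S_def algebra_simps)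
  have Spos: "0 \<le> S" unfolding S(1)[symmetric] using pos by (simp add: mult_nonneg_nonneg)
  have f1: "R * (n - m)\<^sup>2 = S / P" "R' * (n' - m')\<^sup>2 = S / P'"
    "P * (n - m)\<^sup>2 = S / R" "P' * (n' - m')\<^sup>2 = S / R'"
    using pos pos' S by (auto simp: field_simps)
  have le1: "S / P' \<le> S / P" "S / R' \<le> S / R"
    using Spos le RR pos pos' by (auto intro!: divide_left_mono)
  \<comment> \<open>The left side is \<open>q m' - q m\<close>, which equals
    \<open>S / P' - S / P\<close>. The second factor is half the sum of the slopes of
    \<open>q\<close> at \<open>m\<close> and \<open>m'\<close>, hence negative. The upper speeds are
    treated likewise.\<close>
  have d1: "(m' - m) * ((R - P) * m' - A + ((R - P) * m - A)) \<le> 0"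
    using q(2) q'(2) f1 le1 by (simp add: algebra_simps power2_eq_square)
  have d2: "(n - n') * ((R - P) * n' - A + ((R - P) * n - A)) \<le> 0"
    using q(3) q'(3) f1 le1 by (simp add: algebra_simps power2_eq_square)
  have neg: "R' * (n' - m') > 0" "R * (n - m) > 0" "P' * (n' - m') > 0" "P * (n - m) > 0"
    using pos pos' mn mn' by auto
  show "m \<le> m'"
    using d1 neg unfolding q(4) q'(4) by (auto simp: mult_le_0_iff)
  show "n' \<le> n"
    using d2 neg unfolding q(5) q'(5) by (auto simp: mult_le_0_iff)
qed

lemma speeds_exist:
  fixes P R A B S J :: real
  assumes pos: "0 < P" "0 < R" and J: "J = R - P" and S: "0 < S" "S = A\<^sup>2 - J * B"
    and A: "J = 0 \<Longrightarrow> 0 < A"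
  obtains m n where "m < n" "R * n - P * m = A" "R * n\<^sup>2 - P * m\<^sup>2 = B"
proof (cases "J = 0")
  case True
  \<comment> \<open>For equal densities the two conditions read \<open>R (n - m) = A\<close> and
    \<open>A (n + m) = B\<close>, so \<open>D\<close> is the difference and \<open>s\<close> the sum
    of the speeds.\<close>
  define D where "D = A / R"
  define s where "s = B / A"
  have D: "0 < D" using A[OF True] pos by (simp add: D_def)
  have PR: "P = R" using True J by simp
  have 1: "R * D = A" "s * A = B" using A[OF True] pos by (auto simp: D_def s_def)
  have "R * ((s + D) / 2)\<^sup>2 - P * ((s - D) / 2)\<^sup>2 = s * (R * D)"
    unfolding PR by (simp add: power2_eq_square field_simps)
  with 1 have "R * ((s + D) / 2)\<^sup>2 - P * ((s - D) / 2)\<^sup>2 = B" by simp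
  moreover have "R * ((s + D) / 2) - P * ((s - D) / 2) = A"
    unfolding PR 1(1)[symmetric] by (simp add: field_simps)
  ultimately show ?thesis using that[of "(s - D) / 2" "(s + D) / 2"] D by simp
next
  case False
  \<comment> \<open>\<open>D\<close> is \<open>n - m\<close> as forced by the first identity of
    \<open>speeds_quadratic\<close>; the last two, being linear, then give \<open>m\<close> and
    \<open>n\<close>.\<close>
  define D where "D = sqrt (S / (P * R))"
  have D: "0 < D" using S pos by (simp add: D_def)
  have D2: "P * R * D\<^sup>2 = S" using S pos by (simp add: D_def)
  define m where "m = (A - R * D) / J"
  define n where "n = (A - P * D) / J"
  have mJ: "J * m = A - R * D" "J * n = A - P * D" using False by (auto simp: m_def n_def)
  have "J * (n - m) = J * n - J * m" by (simp add: right_diff_distrib)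
  also have "\<dots> = J * D" unfolding mJ unfolding J by (simp add: algebra_simps)
  finally have "J * (n - m) = J * D" .
  then have nm: "n - m = D" using False by simp
  have "J * (R * n - P * m) = R * (J * n) - P * (J * m)" by algebra
  also have "\<dots> = J * A" unfolding mJ unfolding J by algebra
  finally have e1: "R * n - P * m = A" using False by simp
  have "J * J * (R * n\<^sup>2 - P * m\<^sup>2) = R * (J * n)\<^sup>2 - P * (J * m)\<^sup>2" by algebra
  also have "\<dots> = J * (A\<^sup>2 - P * R * D\<^sup>2)" unfolding mJ unfolding J by algebra
  also have "\<dots> = J * J * B" unfolding D2 S(2) by algebra
  finally have e2: "R * n\<^sup>2 - P * m\<^sup>2 = B" using False by simp
  show ?thesis using that[OF _ e1 e2] nm D by simp
qed

section \<open>Moments of nested density profiles\<close>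

text \<open>The difference of the profiles is \<open>- P\<close> on (m, m'), \<open>P' - P\<close>
  on (m', n') and \<open>- R\<close> on (n', n). Against the weight
  \<open>(z - m') * (z - n')\<close> it is nowhere positive, and negative on the middle interval.
  The affine part of the weight meets only the common moments, so what remains is the second moment,
  a third of the change of the cubic jump sum. The identity in the proof is this integral times
  -6.\<close>

lemma third_moment_decreasing:
  fixes P R P' R' A B m n m' n' :: real
  assumes pos: "0 \<le> P" "0 \<le> R" and le: "P < P'" and J: "R - P = R' - P'"
    and mn: "m \<le> m'" "m' < n'" "n' \<le> n"
    and e: "R * n - P * m = A" "R * n\<^sup>2 - P * m\<^sup>2 = B"
    and e': "R' * n' - P' * m' = A" "R' * n'\<^sup>2 - P' * m'\<^sup>2 = B"
  shows "R' * n' ^ 3 - P' * m' ^ 3 < R * n ^ 3 - P * m ^ 3"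
proof -
  define \<alpha> \<delta> \<kappa> where "\<alpha> = m' - m" and "\<delta> = n' - m'" and "\<kappa> = n - n'"
  have sg: "0 \<le> \<alpha>" "0 < \<delta>" "0 \<le> \<kappa>" using mn by (auto simp: \<alpha>_def \<delta>_def \<kappa>_def)
  have z1: "(R * n - P * m) - (R' * n' - P' * m') = 0" using e e' by simp
  have z2: "(R * n\<^sup>2 - P * m\<^sup>2) - (R' * n'\<^sup>2 - P' * m'\<^sup>2) = 0" using e e' by simp
  have R': "R' = R + (P' - P)" using J by simp
  have "2 * ((R * n ^ 3 - P * m ^ 3) - (R' * n' ^ 3 - P' * m' ^ 3))
     = P * (2 * \<alpha> ^ 3 + 3 * \<alpha>\<^sup>2 * \<delta>) + (P' - P) * \<delta> ^ 3 + R * (2 * \<kappa> ^ 3 + 3 * \<kappa>\<^sup>2 * \<delta>)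
       + 3 * (m' + n') * ((R * n\<^sup>2 - P * m\<^sup>2) - (R' * n'\<^sup>2 - P' * m'\<^sup>2))
       - 6 * m' * n' * ((R * n - P * m) - (R' * n' - P' * m'))"
    unfolding R' \<alpha>_def \<delta>_def \<kappa>_def by algebra
  also have "\<dots> > 0" unfolding z1 z2 using sg pos le
    by (simp add: add_nonneg_pos add_pos_nonneg)
  finally show ?thesis by simp
qed

text \<open>The same comparison with the weight \<open>1 / z^2\<close>, which is convex on either
  half-line; the sign conditions and the nesting keep all four speeds on one side of 0. Once
  denominators are cleared, the common moments leave only
  \<open>P * (m' - m) * (n' - m) * (n - m)\<close>.\<close>

lemma inverse_moment_decreasing:
  fixes P R P' R' A B m n m' n' :: real
  assumes pos: "0 \<le> P" and J: "R - P = R' - P'"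
    and mn: "m \<le> m'" "m' \<le> n'" "n' \<le> n"
    and e: "R * n - P * m = A" "R * n\<^sup>2 - P * m\<^sup>2 = B"
    and e': "R' * n' - P' * m' = A" "R' * n'\<^sup>2 - P' * m'\<^sup>2 = B"
    and sgn: "0 < m * n" "0 < m' * n'"
  shows "P' / m' - R' / n' \<le> P / m - R / n"
proof -
  have nz: "m \<noteq> 0" "n \<noteq> 0" "m' \<noteq> 0" "n' \<noteq> 0" using sgn by auto
  have R': "R' = R + (P' - P)" using J by simp
  have z1: "(R * n - P * m) - (R' * n' - P' * m') = 0" using e e' by simp
  have z2: "(R * n\<^sup>2 - P * m\<^sup>2) - (R' * n'\<^sup>2 - P' * m'\<^sup>2) = 0" using e e' by simp
  have "(P / m - R / n - (P' / m' - R' / n')) * ((m * n) * (m' * n'))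
     = (P * n - R * m) * (m' * n') - (P' * n' - R' * m') * (m * n)"
    using nz by (simp add: field_simps)
  also have "\<dots> = P * (m' - m) * (n' - m) * (n - m)
       + (m * n + m * (m' + n')) * ((R * n - P * m) - (R' * n' - P' * m'))
       - m * ((R * n\<^sup>2 - P * m\<^sup>2) - (R' * n'\<^sup>2 - P' * m'\<^sup>2))"
    unfolding R' by algebra
  also have "\<dots> \<ge> 0" unfolding z1 z2 using pos mn by simp
  finally have "0 \<le> (P / m - R / n - (P' / m' - R' / n')) * ((m * n) * (m' * n'))" .
  then show ?thesis using mult_pos_pos[OF sgn] by (simp add: zero_le_mult_iff)
qed

text \<open>With \<open>\<phi> z = z + k / z\<close>, this is the excess of the pressure integral \<open>\<integral> \<rho>\<^sup>2\<close> over a box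
  that cuts off part of the wedge. Replacing \<open>\<rho>\<^sup>2 - r\<^sup>2\<close> by its tangent \<open>2 r (\<rho> - r)\<close> costs squares,
  and the tangent part is controlled by the inverse moments.\<close>

lemma pressure_excess_mono:
  fixes a b r r' A B k m n m' n' :: real
  defines "\<phi> \<equiv> \<lambda>z. z + k / z"
  assumes pos: "a < r" "b < r" and le: "r \<le> r'"
    and mn: "m \<le> m'" "m' \<le> n'" "n' \<le> n"
    and e: "(r - b) * n - (r - a) * m = A" "(r - b) * n\<^sup>2 - (r - a) * m\<^sup>2 = B"
    and e': "(r' - b) * n' - (r' - a) * m' = A" "(r' - b) * n'\<^sup>2 - (r' - a) * m'\<^sup>2 = B"
    and r: "0 \<le> r"
    and k: "k = 0 \<or> 0 < k \<and> (\<forall>x\<in>{m, n, m', n'}. \<forall>y\<in>{m, n, m', n'}. k \<le> x * y)"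
  shows "(r\<^sup>2 - b\<^sup>2) * \<phi> n - (r\<^sup>2 - a\<^sup>2) * \<phi> m \<le> (r'\<^sup>2 - b\<^sup>2) * \<phi> n' - (r'\<^sup>2 - a\<^sup>2) * \<phi> m'"
proof -
  \<comment> \<open>The bound \<open>k \<le> x * y\<close> places all speeds on one branch on which
    \<open>z + k / z\<close> increases.\<close>
  have mono: "\<phi> x \<le> \<phi> y" if "x \<le> y" "x \<in> {m, n, m', n'}" "y \<in> {m, n, m', n'}" for x y
  proof (cases "k = 0")
    case False
    with k have 1: "0 < k" "k \<le> x * y" using that by auto
    then have nz: "x \<noteq> 0" "y \<noteq> 0" by auto
    have "\<phi> y - \<phi> x = (y - x) * (1 - k / (x * y))"
      using nz by (simp add: \<phi>_def field_simps)
    moreover have "k / (x * y) \<le> 1" using 1 by simp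
    ultimately show ?thesis using that(1) by (metis diff_ge_0_iff_ge mult_nonneg_nonneg)
  qed (use that in \<open>simp add: \<phi>_def\<close>)
  \<comment> \<open>\<open>X\<close> integrates the difference of the profiles against the
    increments of \<open>\<phi>\<close>. All of it happens between \<open>m\<close> and
    \<open>n\<close>, where the wider profile is the constant \<open>r\<close>; hence the single
    tangent slope \<open>2 * r\<close> in the identity below.\<close>
  define X where "X = (a - r) * (\<phi> m' - \<phi> m) + (r' - r) * (\<phi> n' - \<phi> m') + (b - r) * (\<phi> n - \<phi> n')"
  have "X = k * (((r - a) / m - (r - b) / n) - ((r' - a) / m' - (r' - b) / n'))
      + ((r' - b) * n' - (r' - a) * m') - ((r - b) * n - (r - a) * m)"
    by (simp add: X_def \<phi>_def algebra_simps diff_divide_distrib)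
  then have X: "X = k * (((r - a) / m - (r - b) / n) - ((r' - a) / m' - (r' - b) / n'))"
    using e e' by simp
  have "0 \<le> X"
  proof (cases "k = 0")
    case False
    with k have kp: "0 < k" and "k \<le> m * n" "k \<le> m' * n'" by auto
    then have "0 < m * n" "0 < m' * n'" by linarith+
    then have "(r' - a) / m' - (r' - b) / n' \<le> (r - a) / m - (r - b) / n"
      by (intro inverse_moment_decreasing[OF _ _ mn e e']) (use pos in auto)
    then show ?thesis unfolding X using kp by simp
  qed (simp add: X)
  have "((r'\<^sup>2 - b\<^sup>2) * \<phi> n' - (r'\<^sup>2 - a\<^sup>2) * \<phi> m') - ((r\<^sup>2 - b\<^sup>2) * \<phi> n - (r\<^sup>2 - a\<^sup>2) * \<phi> m)
     = (a - r)\<^sup>2 * (\<phi> m' - \<phi> m) + (r' - r)\<^sup>2 * (\<phi> n' - \<phi> m') + (b - r)\<^sup>2 * (\<phi> n - \<phi> n') + 2 * r * X"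
    unfolding X_def by algebra
  also have "\<dots> \<ge> 0"
    using mono[of m m'] mono[of m' n'] mono[of n' n] mn r \<open>0 \<le> X\<close> by simp
  finally show ?thesis by simp
qed

section \<open>The fan equations as moment conditions\<close>

text \<open>Differences of the equations for the two signs give the moment conditions on the speeds,
  with right sides free of \<open>r\<close>; the equations at the lower interface are kept to read
  off \<open>\<beta>\<close> and \<open>e\<close>.\<close>

lemma fan_equations_iff:
  assumes "0 < r"
  shows "fan_equations d r m n \<beta> e \<longleftrightarrow> m < n \<and>
    (r - rho_plus d) * n - (r - rho_minus d) * m
      = rho_minus d * vb_minus d - rho_plus d * vb_plus d \<and>
    (r - rho_plus d) * n\<^sup>2 - (r - rho_minus d) * m\<^sup>2
      = (rho_minus d * (vb_minus d)\<^sup>2 + (rho_minus d)\<^sup>2) - (rho_plus d * (vb_plus d)\<^sup>2 + (rho_plus d)\<^sup>2) \<and>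
    r * \<beta> = rho_minus d * vb_minus d + m * (r - rho_minus d) \<and>
    r * (\<beta>\<^sup>2 + e) = rho_minus d * (vb_minus d)\<^sup>2 + (rho_minus d)\<^sup>2 - r\<^sup>2 + m\<^sup>2 * (r - rho_minus d)"
    (is "?L \<longleftrightarrow> ?R")
proof
  assume L: ?L
  then have 1: "m * (rho_minus d - r) = rho_minus d * vb_minus d - r * \<beta>"
    "n * (rho_plus d - r) = rho_plus d * vb_plus d - r * \<beta>"
    and "m * (rho_minus d * vb_minus d - r * \<beta>) =
       rho_minus d * (vb_minus d)\<^sup>2 + (rho_minus d)\<^sup>2 - r * (\<beta>\<^sup>2 + e) - r\<^sup>2"
     "n * (rho_plus d * vb_plus d - r * \<beta>) =
       rho_plus d * (vb_plus d)\<^sup>2 + (rho_plus d)\<^sup>2 - r * (\<beta>\<^sup>2 + e) - r\<^sup>2"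
    by (simp_all add: fan_equations_def pressure_def)
  from this(3,4) have 2: "m * (m * (rho_minus d - r)) =
       rho_minus d * (vb_minus d)\<^sup>2 + (rho_minus d)\<^sup>2 - r * (\<beta>\<^sup>2 + e) - r\<^sup>2"
     "n * (n * (rho_plus d - r)) =
       rho_plus d * (vb_plus d)\<^sup>2 + (rho_plus d)\<^sup>2 - r * (\<beta>\<^sup>2 + e) - r\<^sup>2"
    unfolding 1 by auto
  show ?R using 1 2 L by (simp add: fan_equations_def algebra_simps power2_eq_square)
next
  assume R: ?R
  then have 1: "m * (rho_minus d - r) = rho_minus d * vb_minus d - r * \<beta>"
    "n * (rho_plus d - r) = rho_plus d * vb_plus d - r * \<beta>"
    and 2: "m * (m * (rho_minus d - r)) =
       rho_minus d * (vb_minus d)\<^sup>2 + (rho_minus d)\<^sup>2 - r * (\<beta>\<^sup>2 + e) - r\<^sup>2"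
     "n * (n * (rho_plus d - r)) =
       rho_plus d * (vb_plus d)\<^sup>2 + (rho_plus d)\<^sup>2 - r * (\<beta>\<^sup>2 + e) - r\<^sup>2"
    by (simp_all add: algebra_simps power2_eq_square)
  then show ?L using R 1 2[unfolded 1] unfolding fan_equations_def pressure_def by blast
qed

lemma fan_equations_mono:
  assumes f: "fan_equations d r m n \<beta> e" "fan_equations d r' m' n' \<beta>' e'"
    and r: "0 < rho_minus d" "rho_max d < r" "r \<le> r'"
  shows "m \<le> m'" "n' \<le> n"
proof -
  have pos: "0 < r" "0 < r'" using r by (auto simp: rho_max_def)
  have gt: "rho_minus d < r" "rho_plus d < r" using r by (auto simp: rho_max_def)
  note F = f(1)[unfolded fan_equations_iff[OF pos(1)]] f(2)[unfolded fan_equations_iff[OF pos(2)]]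
  have le: "0 < r - rho_minus d" "0 < r - rho_plus d" "r - rho_minus d \<le> r' - rho_minus d"
    "(r - rho_plus d) - (r - rho_minus d) = (r' - rho_plus d) - (r' - rho_minus d)"
    using gt r by auto
  from F show "m \<le> m'" "n' \<le> n"
    by (auto intro: speeds_mono[OF le])
qed

text \<open>Monotonicity at equal densities, applied in both directions, identifies the speeds;
  these determine \<open>\<beta>\<close> and then \<open>e\<close>.\<close>

lemma fan_equations_unique:
  assumes f: "fan_equations d r m n \<beta> e" "fan_equations d r m' n' \<beta>' e'"
    and r: "0 < rho_minus d" "rho_max d < r"
  shows "m = m'" "n = n'" "\<beta> = \<beta>'" "e = e'"
proof -
  have pos: "0 < r" using r by (auto simp: rho_max_def)
  show mn: "m = m'" "n = n'"
    using fan_equations_mono[OF f r] fan_equations_mono[OF f(2,1) r] by auto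
  have 1: "r * \<beta> = r * \<beta>'"
    using f[unfolded fan_equations_iff[OF pos], THEN conjunct2, THEN conjunct2, THEN conjunct2, THEN conjunct1]
    by (simp only: mn)
  then show "\<beta> = \<beta>'" using pos by simp
  then have "r * (\<beta>'\<^sup>2 + e) = r * (\<beta>'\<^sup>2 + e')"
    using f[unfolded fan_equations_iff[OF pos], THEN conjunct2, THEN conjunct2, THEN conjunct2, THEN conjunct2]
    by (simp only: mn)
  then show "e = e'" using pos by simp
qed

lemma fan_parameters_eq:
  assumes f: "fan_equations d r m n \<beta> e" and r: "0 < rho_minus d" "rho_max d < r"
  shows "nu_minus d r = m" "nu_plus d r = n" "beta d r = \<beta>" "eps1 d r = e"
proof -
  note u = fan_equations_unique[OF _ f r]
  show "nu_minus d r = m" unfolding nu_minus_def by (rule the_equality) (use f u(1) in blast)+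
  show "nu_plus d r = n" unfolding nu_plus_def by (rule the_equality) (use f u(2) in blast)+
  show "beta d r = \<beta>" unfolding beta_def by (rule the_equality) (use f u(3) in blast)+
  show "eps1 d r = e" unfolding eps1_def by (rule the_equality) (use f u(4) in blast)+
qed

lemma fan_equations_fan_parameters:
  assumes r: "0 < rho_minus d" "rho_max d < r"
    and v: "0 < rho_plus d" "vb_plus d < vb_minus d" and S: "0 < S_data d"
  shows "fan_equations d r (nu_minus d r) (nu_plus d r) (beta d r) (eps1 d r)"
proof -
  have pos: "0 < r" using r by (auto simp: rho_max_def)
  define a b v w where abvw: "a = rho_minus d" "b = rho_plus d" "v = vb_minus d" "w = vb_plus d"
  have ineq: "0 < a" "0 < b" "a < r" "b < r" "w < v" using r v by (auto simp: abvw rho_max_def)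
  \<comment> \<open>\<open>S_data\<close> is the quantity \<open>A^2 - J B\<close> of the speed
    equations, so its positivity is exactly what their solvability asks for.\<close>
  have "S_data d = (a * v - b * w)\<^sup>2 - (a - b) * ((a * v\<^sup>2 + a\<^sup>2) - (b * w\<^sup>2 + b\<^sup>2))"
    unfolding S_data_def pressure_def abvw[symmetric] by algebra
  with S obtain m n where mn: "m < n" "(r - b) * n - (r - a) * m = a * v - b * w"
    "(r - b) * n\<^sup>2 - (r - a) * m\<^sup>2 = (a * v\<^sup>2 + a\<^sup>2) - (b * w\<^sup>2 + b\<^sup>2)"
    using speeds_exist[of "r - a" "r - b" "a - b" "S_data d" "a * v - b * w"
        "(a * v\<^sup>2 + a\<^sup>2) - (b * w\<^sup>2 + b\<^sup>2)"] ineq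
    by auto
  define \<beta> where "\<beta> = (a * v + m * (r - a)) / r"
  define e where "e = (a * v\<^sup>2 + a\<^sup>2 - r\<^sup>2 + m\<^sup>2 * (r - a)) / r - \<beta>\<^sup>2"
  have "fan_equations d r m n \<beta> e"
    unfolding fan_equations_iff[OF pos] abvw[symmetric]
    using mn pos by (auto simp: \<beta>_def e_def)
  with fan_parameters_eq[OF this r] show ?thesis by simp
qed

text \<open>The part of the action that depends on the fan, at \<epsilon>2 = 0 and up to the factor
  \<open>L3 * T^2\<close>: volumes below an interface are affine in \<open>\<phi>\<close> of its
  speed, and the constant terms add up to the same value for all fans.\<close>

lemma fan_action_decreasing:
  fixes d k
  defines "\<phi> \<equiv> \<lambda>z. z + k / z"
    and "Lm \<equiv> rho_minus d * (vb_minus d)\<^sup>2 / 2 - (rho_minus d)\<^sup>2"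
    and "Lp \<equiv> rho_plus d * (vb_plus d)\<^sup>2 / 2 - (rho_plus d)\<^sup>2"
    and "Lmid \<equiv> \<lambda>r \<beta> e. r * (\<beta>\<^sup>2 + e) / 2 - r\<^sup>2"
  assumes f: "fan_equations d r m n \<beta> e" "fan_equations d r' m' n' \<beta>' e'"
    and r: "0 < rho_minus d" "rho_max d < r" "r < r'"
    and k: "k = 0 \<or> 0 < k \<and> (\<forall>x\<in>{m, n, m', n'}. \<forall>y\<in>{m, n, m', n'}. k \<le> x * y)"
  shows "(Lm - Lmid r' \<beta>' e') * \<phi> m' + (Lmid r' \<beta>' e' - Lp) * \<phi> n'
       < (Lm - Lmid r \<beta> e) * \<phi> m + (Lmid r \<beta> e - Lp) * \<phi> n"
proof -
  define a b v w where abvw: "a = rho_minus d" "b = rho_plus d" "v = vb_minus d" "w = vb_plus d"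
  have pos: "0 < r" "0 < r'" and gt: "a < r" "b < r" using r by (auto simp: rho_max_def abvw)
  define A where "A = a * v - b * w"
  define B where "B = (a * v\<^sup>2 + a\<^sup>2) - (b * w\<^sup>2 + b\<^sup>2)"
  note F = f(1)[unfolded fan_equations_iff[OF pos(1)] abvw[symmetric], folded A_def B_def]
    f(2)[unfolded fan_equations_iff[OF pos(2)] abvw[symmetric], folded A_def B_def]
  have mn: "m \<le> m'" "m' < n'" "n' \<le> n" using fan_equations_mono[OF f] r F by auto
  have G: "(r\<^sup>2 - b\<^sup>2) * \<phi> n - (r\<^sup>2 - a\<^sup>2) * \<phi> m \<le> (r'\<^sup>2 - b\<^sup>2) * \<phi> n' - (r'\<^sup>2 - a\<^sup>2) * \<phi> m'"
    unfolding \<phi>_def using F mn gt r pos k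
    by (intro pressure_excess_mono[where A = A and B = B]) auto
  have M: "(r' - b) * n' ^ 3 - (r' - a) * m' ^ 3 < (r - b) * n ^ 3 - (r - a) * m ^ 3"
    using F mn gt r by (intro third_moment_decreasing[where A = A and B = B]) auto
  \<comment> \<open>The fan equations turn the jumps of the Lagrangian into multiples of
    \<open>x^2\<close> and \<open>y^2\<close> plus pressure jumps. Since
    \<open>x^2 * \<phi> x = x^3 + k * x\<close>, the cut leaves the constant \<open>k * A\<close> in
    the flux part.\<close>
  have key: "2 * ((Lm - Lmid s \<gamma> c) * \<phi> x + (Lmid s \<gamma> c - Lp) * \<phi> y)
      = ((s - b) * y ^ 3 - (s - a) * x ^ 3) + k * A
        - 3 * ((s\<^sup>2 - b\<^sup>2) * \<phi> y - (s\<^sup>2 - a\<^sup>2) * \<phi> x)"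
    if E: "(s - b) * y - (s - a) * x = A" "(s - b) * y\<^sup>2 - (s - a) * x\<^sup>2 = B"
      "s * (\<gamma>\<^sup>2 + c) = a * v\<^sup>2 + a\<^sup>2 - s\<^sup>2 + x\<^sup>2 * (s - a)" and z: "k = 0 \<or> x \<noteq> 0 \<and> y \<noteq> 0"
    for s \<gamma> c x y
  proof -
    have p: "x\<^sup>2 * \<phi> x = x ^ 3 + k * x" "y\<^sup>2 * \<phi> y = y ^ 3 + k * y"
      using z by (auto simp: \<phi>_def power2_eq_square power3_eq_cube algebra_simps)
    have 1: "2 * (Lm - Lmid s \<gamma> c) = 3 * (s\<^sup>2 - a\<^sup>2) - (s - a) * x\<^sup>2"
      unfolding Lm_def Lmid_def abvw[symmetric] using E(3) by (simp add: field_simps)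
    have 2: "2 * (Lmid s \<gamma> c - Lp) = (s - b) * y\<^sup>2 - 3 * (s\<^sup>2 - b\<^sup>2)"
      unfolding Lp_def Lmid_def abvw[symmetric] using E(2,3) by (simp add: B_def field_simps)
    have "2 * ((Lm - Lmid s \<gamma> c) * \<phi> x + (Lmid s \<gamma> c - Lp) * \<phi> y)
        = (2 * (Lm - Lmid s \<gamma> c)) * \<phi> x + (2 * (Lmid s \<gamma> c - Lp)) * \<phi> y" by algebra
    also have "\<dots> = (s - b) * (y\<^sup>2 * \<phi> y) - (s - a) * (x\<^sup>2 * \<phi> x)
        - 3 * ((s\<^sup>2 - b\<^sup>2) * \<phi> y - (s\<^sup>2 - a\<^sup>2) * \<phi> x)" unfolding 1 2 by algebra
    also have "\<dots> = ((s - b) * y ^ 3 - (s - a) * x ^ 3) + k * ((s - b) * y - (s - a) * x)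
        - 3 * ((s\<^sup>2 - b\<^sup>2) * \<phi> y - (s\<^sup>2 - a\<^sup>2) * \<phi> x)" unfolding p by algebra
    finally show ?thesis unfolding E(1) .
  qed
  have nz: "k = 0 \<or> m \<noteq> 0 \<and> n \<noteq> 0" "k = 0 \<or> m' \<noteq> 0 \<and> n' \<noteq> 0"
    using k by auto
  have "2 * ((Lm - Lmid r' \<beta>' e') * \<phi> m' + (Lmid r' \<beta>' e' - Lp) * \<phi> n')
      < 2 * ((Lm - Lmid r \<beta> e) * \<phi> m + (Lmid r \<beta> e - Lp) * \<phi> n)"
    using G M by (subst (1 2) key) (use F nz in auto)
  then show ?thesis by simp
qed

section \<open>Volumes of wedges in a box\<close>

lemma AE_shock_line: "AE z in lborel. snd z $ 2 \<noteq> \<nu> * fst (z :: spacetime)"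
proof -
  have "negligible {z :: spacetime. (- \<nu>, axis 2 1) \<bullet> z = 0}"
    by (rule negligible_hyperplane) (auto simp: zero_prod_def axis_eq_0_iff)
  also have "{z :: spacetime. (- \<nu>, axis 2 1) \<bullet> z = 0} = {z. snd z $ 2 = \<nu> * fst z}"
    by (auto simp: inner_prod_def inner_axis')
  finally have "{z :: spacetime. snd z $ 2 = \<nu> * fst z} \<in> null_sets lebesgue"
    by (simp add: negligible_iff_null_sets)
  then have "AE z in lebesgue. snd z $ 2 \<noteq> \<nu> * fst (z :: spacetime)"
    by (auto dest: AE_not_in)
  then show ?thesis by (simp add: AE_completion_iff)
qed

lemma AE_time_nonzero: "AE z in lborel. fst (z :: spacetime) \<noteq> 0"
proof -
  have "negligible {z :: spacetime. (1, 0) \<bullet> z = 0}"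
    by (rule negligible_hyperplane) (auto simp: zero_prod_def)
  also have "{z :: spacetime. (1, 0) \<bullet> z = 0} = {z. fst z = 0}"
    by (auto simp: inner_prod_def)
  finally have "{z :: spacetime. fst z = 0} \<in> null_sets lebesgue"
    by (simp add: negligible_iff_null_sets)
  then have "AE z in lebesgue. fst (z :: spacetime) \<noteq> 0"
    by (auto dest: AE_not_in)
  then show ?thesis by (simp add: AE_completion_iff)
qed

text \<open>The whole half-space below one interface, not the region between two of them. For
  positive times and up to null sets the fan region is a difference of two such sets, which makes
  all later integrals telescope.\<close>

definition wedge :: "real \<Rightarrow> spacetime set" where
  "wedge \<nu> = {z. snd z $ 2 < \<nu> * fst z}"

definition space_box :: "real \<Rightarrow> real \<Rightarrow> real \<Rightarrow> (real^2) set" where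
  "space_box L3 l1 l2 = cbox (vector [-L3, l1]) (vector [L3, l2])"

lemma mem_space_box: "x \<in> space_box L3 l1 l2 \<longleftrightarrow> x $ 1 \<in> {-L3..L3} \<and> x $ 2 \<in> {l1..l2}"
  by (auto simp: space_box_def mem_box_cart forall_2)

lemma emeasure_space_box:
  assumes "0 \<le> L3"
  shows "emeasure lborel (space_box L3 l1 l2) = ennreal (2 * L3 * max 0 (l2 - l1))"
proof -
  have ne: "space_box L3 l1 l2 = {} \<longleftrightarrow> l2 < l1"
  proof -
    have "(\<exists>i. P i) \<longleftrightarrow> P 1 \<or> P 2" for P :: "2 \<Rightarrow> bool" by (metis exhaust_2)
    then show ?thesis using assms by (auto simp: space_box_def interval_eq_empty_cart)
  qed
  have "emeasure lborel (space_box L3 l1 l2) = ennreal (measure lborel (space_box L3 l1 l2))"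
    unfolding space_box_def by (intro emeasure_eq_ennreal_measure) (simp add: emeasure_lborel_cbox_eq)
  also have "measure lborel (space_box L3 l1 l2) = 2 * L3 * max 0 (l2 - l1)"
    using ne unfolding space_box_def content_cbox_if_cart by (auto simp: UNIV_2 max_def)
  finally show ?thesis .
qed

lemma wedge_measurable[measurable]: "wedge \<nu> \<in> sets borel"
proof -
  have "open (wedge \<nu>)" unfolding wedge_def by (intro open_Collect_less continuous_intros)
  then show ?thesis by simp
qed

lemma space_time_box_eq:
  "{(t, x). t \<in> {0..T} \<and> x $ 1 \<in> {-L3..L3} \<and> x $ 2 \<in> {l1..l2}} = {0..T} \<times> space_box L3 l1 l2"
  by (auto simp: mem_space_box)

lemma emeasure_box_wedge:
  assumes "0 \<le> L3"
    and I: "((\<lambda>t. max 0 (min l2 (\<nu> * t) - l1)) has_integral V) {0..T}"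
  shows "emeasure lborel (({0..T} \<times> space_box L3 l1 l2) \<inter> wedge \<nu>) = ennreal (2 * L3 * V)"
proof -
  \<comment> \<open>Adding the interface changes only a null set and makes every time slice a closed
    box again.\<close>
  define W where "W = ({0..T} \<times> space_box L3 l1 l2) \<inter> {z. snd z $ 2 \<le> \<nu> * fst z}"
  have cl: "closed W" unfolding W_def space_box_def
    by (intro closed_Int closed_Times closed_Collect_le continuous_intros closed_atLeastAtMost closed_cbox)
  have "emeasure lborel (({0..T} \<times> space_box L3 l1 l2) \<inter> wedge \<nu>) = emeasure lborel W"
  proof (rule emeasure_eq_AE)
    show "AE z in lborel. z \<in> ({0..T} \<times> space_box L3 l1 l2) \<inter> wedge \<nu> \<longleftrightarrow> z \<in> W"
      using AE_shock_line[of \<nu>] by eventually_elim (auto simp: W_def wedge_def)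
    have "closed ({0..T} \<times> space_box L3 l1 l2)" unfolding space_box_def
      by (intro closed_Times closed_atLeastAtMost closed_cbox)
    then show "({0..T} \<times> space_box L3 l1 l2) \<inter> wedge \<nu> \<in> sets lborel" by simp
    show "W \<in> sets lborel" using cl by simp
  qed
  also have "\<dots> = emeasure (lborel \<Otimes>\<^sub>M lborel) W" by (simp add: lborel_prod)
  also have "\<dots> = (\<integral>\<^sup>+t. emeasure lborel (Pair t -` W) \<partial>lborel)"
    using cl by (intro lborel.emeasure_pair_measure_alt) (simp only: lborel_prod sets_lborel borel_closed)
  also have "\<dots> = (\<integral>\<^sup>+t. ennreal (if t \<in> {0..T} then 2 * L3 * max 0 (min l2 (\<nu> * t) - l1) else 0) \<partial>lborel)"
  proof (rule nn_integral_cong)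
    fix t
    have "Pair t -` W = (if t \<in> {0..T} then space_box L3 l1 (min l2 (\<nu> * t)) else {})"
      by (auto simp: W_def mem_space_box)
    then show "emeasure lborel (Pair t -` W)
        = ennreal (if t \<in> {0..T} then 2 * L3 * max 0 (min l2 (\<nu> * t) - l1) else 0)"
      using emeasure_space_box[OF assms(1)] by simp
  qed
  also have "\<dots> = ennreal (2 * L3 * V)"
  proof (rule nn_integral_has_integral_lborel)
    show "((\<lambda>t. if t \<in> {0..T} then 2 * L3 * max 0 (min l2 (\<nu> * t) - l1) else 0) has_integral 2 * L3 * V) UNIV"
      unfolding has_integral_restrict_UNIV using has_integral_mult_right[OF I, of "2 * L3"] .
  qed (use assms(1) in auto)
  finally show ?thesis .
qed

lemma has_integral_max_ramp:
  fixes \<mu> l T :: real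
  assumes "0 < \<mu>" "0 \<le> l" "l \<le> \<mu> * T"
  shows "((\<lambda>t. max 0 (\<mu> * t - l)) has_integral (\<mu> * T - l)\<^sup>2 / (2 * \<mu>)) {0..T}"
proof -
  \<comment> \<open>The time at which the interface enters the box; the integrand vanishes before
    it.\<close>
  define s where "s = l / \<mu>"
  have s: "0 \<le> s" "s \<le> T" "\<mu> * s = l" using assms by (auto simp: s_def field_simps)
  have "((\<lambda>t. \<mu> * t - l) has_integral (\<mu> * T - l)\<^sup>2 / (2 * \<mu>) - (\<mu> * s - l)\<^sup>2 / (2 * \<mu>)) {s..T}"
    using assms s
    by (intro fundamental_theorem_of_calculus)
      (auto intro!: derivative_eq_intros simp: has_real_derivative_iff_has_vector_derivative[symmetric] field_simps)
  then have "((\<lambda>t. \<mu> * t - l) has_integral (\<mu> * T - l)\<^sup>2 / (2 * \<mu>)) {s..T}" using s by simp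
  then have 2: "((\<lambda>t. max 0 (\<mu> * t - l)) has_integral (\<mu> * T - l)\<^sup>2 / (2 * \<mu>)) {s..T}"
    by (rule has_integral_eq[rotated]) (use assms(1) s in \<open>auto simp: max_def mult_left_mono simp flip: s(3)\<close>)
  have 1: "((\<lambda>t. max 0 (\<mu> * t - l)) has_integral 0) {0..s}"
    by (rule has_integral_is_0) (use assms(1) s in \<open>auto simp: max_def simp flip: s(3)\<close>)
  show ?thesis using has_integral_combine[OF s(1,2) 1 2] by simp
qed

text \<open>If the box contains no point of the line \<open>x\<^sub>2 = 0\<close>, it cuts off the tip of the wedge;
  \<open>k\<close> is the square of the slope at which it does.\<close>

lemma box_wedge_volume:
  assumes L3: "0 < L3" and T: "0 < T" and l: "l1 < l2"
  obtains c k where "k = 0 \<or> 0 < k \<and> (\<forall>x y. l1 < T * x \<and> T * x < l2 \<and> l1 < T * y \<and> T * y < l2 \<longrightarrow> k \<le> x * y)"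
    and "\<And>\<nu>. l1 < T * \<nu> \<Longrightarrow> T * \<nu> < l2 \<Longrightarrow>
      measure lborel (({0..T} \<times> space_box L3 l1 l2) \<inter> wedge \<nu>) = c + L3 * T\<^sup>2 * (\<nu> + k / \<nu>)"
proof -
  have meas: "measure lborel (({0..T} \<times> space_box L3 l1 l2) \<inter> wedge \<nu>) = 2 * L3 * V"
    if "((\<lambda>t. max 0 (min l2 (\<nu> * t) - l1)) has_integral V) {0..T}" for \<nu> V
  proof -
    have "0 \<le> V" using that by (rule has_integral_nonneg) auto
    then show ?thesis using emeasure_box_wedge[OF _ that, of L3] L3 by (simp add: measure_def)
  qed
  consider (mid) "l1 \<le> 0" "0 \<le> l2" | (up) "0 < l1" | (down) "l2 < 0" by linarith
  then show ?thesis
  proof cases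
    case mid
    show ?thesis
    proof (rule that[of 0 "2 * L3 * (- l1 * T)"])
      fix \<nu> assume \<nu>: "l1 < T * \<nu>" "T * \<nu> < l2"
      have in_box: "l1 \<le> \<nu> * t \<and> \<nu> * t \<le> l2" if "t \<in> {0..T}" for t
      proof -
        have t: "0 \<le> t / T" "t / T \<le> 1" using that T by auto
        have "\<nu> * t = (t / T) * (T * \<nu>)" using T by simp
        moreover have "(t / T) * l1 \<le> (t / T) * (T * \<nu>)" "(t / T) * (T * \<nu>) \<le> (t / T) * l2"
          using \<nu> t by (intro mult_left_mono; simp)+
        moreover have "1 * l1 \<le> (t / T) * l1" "(t / T) * l2 \<le> 1 * l2"
          using t mid by (intro mult_right_mono_neg mult_right_mono; simp)+
        ultimately show ?thesis by linarith
      qed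
      have "((\<lambda>t. \<nu> * t - l1) has_integral (\<nu> * T\<^sup>2 / 2 - l1 * T) - (\<nu> * 0\<^sup>2 / 2 - l1 * 0)) {0..T}"
        using T by (intro fundamental_theorem_of_calculus)
          (auto intro!: derivative_eq_intros simp: has_real_derivative_iff_has_vector_derivative[symmetric])
      then have "((\<lambda>t. max 0 (min l2 (\<nu> * t) - l1)) has_integral \<nu> * T\<^sup>2 / 2 - l1 * T) {0..T}"
        by (rule has_integral_eq[rotated, THEN has_integral_eq_rhs])
          (use in_box in \<open>auto simp: max_def min_def dest: order_antisym\<close>)
      from meas[OF this]
      show "measure lborel (({0..T} \<times> space_box L3 l1 l2) \<inter> wedge \<nu>)
          = 2 * L3 * (- l1 * T) + L3 * T\<^sup>2 * (\<nu> + 0 / \<nu>)"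
        by (simp add: algebra_simps)
    qed simp
  next
    case up
    have k: "(l1 / T)\<^sup>2 \<le> x * y" if "l1 < T * x" "l1 < T * y" for x y
    proof -
      have "l1 / T \<le> x" "l1 / T \<le> y" "0 \<le> l1 / T" using that T up by (auto simp: field_simps)
      then show ?thesis unfolding power2_eq_square by (intro mult_mono) auto
    qed
    show ?thesis
    \<comment> \<open>The constants come from expanding the square in
      \<open>L3 * (\<nu> * T - l1)^2 / \<nu>\<close>.\<close>
    proof (rule that[of "(l1 / T)\<^sup>2" "2 * L3 * (- l1 * T)"])
      fix \<nu> assume \<nu>: "l1 < T * \<nu>" "T * \<nu> < l2"
      have pos: "0 < \<nu>" using \<nu> up T by (metis less_trans zero_less_mult_pos)
      have "((\<lambda>t. max 0 (\<nu> * t - l1)) has_integral (\<nu> * T - l1)\<^sup>2 / (2 * \<nu>)) {0..T}"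
        using pos up \<nu> by (intro has_integral_max_ramp) (auto simp: mult.commute)
      then have "((\<lambda>t. max 0 (min l2 (\<nu> * t) - l1)) has_integral (\<nu> * T - l1)\<^sup>2 / (2 * \<nu>)) {0..T}"
      proof (rule has_integral_eq[rotated])
        fix t assume "t \<in> {0..T}"
        then have "\<nu> * t \<le> \<nu> * T" using pos by simp
        then show "max 0 (\<nu> * t - l1) = max 0 (min l2 (\<nu> * t) - l1)" using \<nu> by (simp add: mult.commute min_def)
      qed
      then have "measure lborel (({0..T} \<times> space_box L3 l1 l2) \<inter> wedge \<nu>)
          = 2 * L3 * ((\<nu> * T - l1)\<^sup>2 / (2 * \<nu>))"
        by (rule meas)
      also have "\<dots> = 2 * L3 * (- l1 * T) + L3 * T\<^sup>2 * (\<nu> + (l1 / T)\<^sup>2 / \<nu>)"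
        using pos T by (simp add: field_simps power2_eq_square)
      finally show "measure lborel (({0..T} \<times> space_box L3 l1 l2) \<inter> wedge \<nu>) = \<dots>" .
    qed (use up T k in auto)
  next
    case down
    have k: "(l2 / T)\<^sup>2 \<le> x * y" if "T * x < l2" "T * y < l2" for x y
    proof -
      have "- l2 / T \<le> - x" "- l2 / T \<le> - y" "0 \<le> - l2 / T" using that T down by (auto simp: field_simps)
      then have "(- l2 / T) * (- l2 / T) \<le> (- x) * (- y)" by (intro mult_mono) auto
      then show ?thesis by (simp add: power2_eq_square)
    qed
    show ?thesis
    proof (rule that[of "(l2 / T)\<^sup>2" "2 * L3 * ((l2 - l1) * T - l2 * T)"])
      fix \<nu> assume \<nu>: "l1 < T * \<nu>" "T * \<nu> < l2"
      have neg: "0 < - \<nu>" using \<nu> down T by (simp add: mult_less_0_iff) (metis less_trans mult_less_0_iff not_less_iff_gr_or_eq)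
      \<comment> \<open>Below 0 the part of the slice above the interface is the ramp: slope
        \<open>- \<nu>\<close>, starting when the interface passes \<open>l2\<close>. It is
        subtracted from the full height \<open>l2 - l1\<close>.\<close>
      have "((\<lambda>t. max 0 ((- \<nu>) * t - (- l2))) has_integral ((- \<nu>) * T - (- l2))\<^sup>2 / (2 * (- \<nu>))) {0..T}"
        using neg down \<nu> by (intro has_integral_max_ramp) (auto simp: mult.commute)
      from has_integral_diff[OF has_integral_const_real[of "l2 - l1" 0 T] this]
      have "((\<lambda>t. max 0 (min l2 (\<nu> * t) - l1)) has_integral
          measure lborel {0..T} *\<^sub>R (l2 - l1) - ((- \<nu>) * T - (- l2))\<^sup>2 / (2 * (- \<nu>))) {0..T}"
      proof (rule has_integral_eq[rotated])
        fix t assume "t \<in> {0..T}"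
        then have "\<nu> * T \<le> \<nu> * t" using neg by simp
        then show "(l2 - l1) - max 0 ((- \<nu>) * t - (- l2)) = max 0 (min l2 (\<nu> * t) - l1)"
          using \<nu> l by (simp add: mult.commute min_def max_def)
      qed
      then have "measure lborel (({0..T} \<times> space_box L3 l1 l2) \<inter> wedge \<nu>)
          = 2 * L3 * (measure lborel {0..T} *\<^sub>R (l2 - l1) - ((- \<nu>) * T - (- l2))\<^sup>2 / (2 * (- \<nu>)))"
        by (rule meas)
      also have "\<dots> = 2 * L3 * ((l2 - l1) * T - l2 * T) + L3 * T\<^sup>2 * (\<nu> + (l2 / T)\<^sup>2 / \<nu>)"
        using neg T by (simp add: field_simps power2_eq_square)
      finally show "measure lborel (({0..T} \<times> space_box L3 l1 l2) \<inter> wedge \<nu>) = \<dots>" .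
    qed (use down T k in auto)
  qed
qed

section \<open>Weak pairing of piecewise constant fields\<close>

text \<open>Each time slice is merely translated, so Fubini gives invariance. The shear straightens
  a moving interface.\<close>

lemma lborel_shear:
  fixes h :: "'b::euclidean_space"
  shows "distr lborel borel (\<lambda>(t::real, x). (t, x + t *\<^sub>R h)) = lborel"
proof -
  let ?\<sigma> = "\<lambda>(t::real, x). (t, x + t *\<^sub>R h)"
  have m[measurable]: "?\<sigma> \<in> borel \<rightarrow>\<^sub>M borel"
    by (intro borel_measurable_continuous_onI) (auto simp: case_prod_unfold intro!: continuous_intros)
  show ?thesis
  proof (rule measure_eqI)
    fix X :: "(real \<times> 'b) set" assume "X \<in> sets (distr lborel borel ?\<sigma>)"
    then have X[measurable]: "X \<in> sets borel" by simp
    have X': "X \<in> sets (lborel \<Otimes>\<^sub>M lborel)" by (simp only: lborel_prod sets_lborel X)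
    have "?\<sigma> -` X \<in> sets (borel :: (real \<times> 'b) measure)" using measurable_sets[OF m X] by simp
    then have pre: "?\<sigma> -` X \<in> sets (lborel \<Otimes>\<^sub>M lborel)" by (simp only: lborel_prod sets_lborel)
    have "emeasure (distr lborel borel ?\<sigma>) X = emeasure lborel (?\<sigma> -` X)"
      by (subst emeasure_distr) auto
    also have "\<dots> = emeasure (lborel \<Otimes>\<^sub>M lborel) (?\<sigma> -` X)" by (simp add: lborel_prod)
    also have "\<dots> = (\<integral>\<^sup>+t. emeasure lborel (Pair t -` (?\<sigma> -` X)) \<partial>lborel)"
      by (rule lborel.emeasure_pair_measure_alt[OF pre])
    also have "\<dots> = (\<integral>\<^sup>+t. emeasure lborel (Pair t -` X) \<partial>lborel)"
    proof (rule nn_integral_cong)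
      fix t :: real
      have sl: "Pair t -` X \<in> sets (borel :: 'b measure)"
        using sets_Pair1[OF X'] by simp
      have "emeasure lborel (Pair t -` (?\<sigma> -` X)) = emeasure lborel ((+) (t *\<^sub>R h) -` (Pair t -` X))"
        by (intro arg_cong[where f = "emeasure lborel"]) (auto simp: add.commute)
      also have "\<dots> = emeasure (distr lborel borel ((+) (t *\<^sub>R h))) (Pair t -` X)"
        using sl by (subst emeasure_distr) auto
      finally show "emeasure lborel (Pair t -` (?\<sigma> -` X)) = emeasure lborel (Pair t -` X)"
        by (simp add: lborel_distr_plus)
    qed
    also have "\<dots> = emeasure (lborel \<Otimes>\<^sub>M lborel) X"
      by (rule lborel.emeasure_pair_measure_alt[OF X', symmetric])
    finally show "emeasure (distr lborel borel ?\<sigma>) X = emeasure lborel X" by (simp add: lborel_prod)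
  qed simp
qed

lemma integrable_indicator_compact_support:
  fixes g :: "'a::euclidean_space \<Rightarrow> real"
  assumes "continuous_on UNIV g" "\<And>x. R < norm x \<Longrightarrow> g x = 0" "W \<in> sets borel"
  shows "integrable lborel (\<lambda>x. indicator W x * g x)"
proof -
  have "integrable lborel (\<lambda>x. indicator (cball 0 R) x *\<^sub>R g x)"
    by (rule borel_integrable_compact) (auto intro: continuous_on_subset[OF assms(1)])
  from integrable_mult_indicator[OF _ this, of W]
  have "integrable lborel (\<lambda>x. indicator W x *\<^sub>R (indicator (cball 0 R) x *\<^sub>R g x))"
    using assms(3) by simp
  moreover have "(\<lambda>x. indicator W x *\<^sub>R (indicator (cball 0 R) x *\<^sub>R g x)) = (\<lambda>x. indicator W x * g x)"
    using assms(2) by (auto simp: indicator_def fun_eq_iff)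
  ultimately show ?thesis by simp
qed

section \<open>Integrals of directional derivatives over translated sets\<close>

locale compactly_supported_C1 =
  fixes \<phi> :: "'a::euclidean_space \<Rightarrow> real"
  assumes differentiable: "\<phi> differentiable (at x)"
    and continuous_deriv: "continuous_on UNIV (\<lambda>x. frechet_derivative \<phi> (at x) h)"
    and bounded_support: "\<exists>R. \<forall>x. R < norm x \<longrightarrow> \<phi> x = 0"
begin

definition D :: "'a \<Rightarrow> 'a \<Rightarrow> real" where
  "D h x = frechet_derivative \<phi> (at x) h"

lemma has_derivative_D: "(\<phi> has_derivative (\<lambda>h. D h x)) (at x)"
  using differentiable[of x] by (simp add: D_def frechet_derivative_works)

lemma D_add: "D (h + h') x = D h x + D h' x" and D_scale: "D (c *\<^sub>R h) x = c * D h x"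
  using has_derivative_linear[OF has_derivative_D[of x]] by (auto dest: linear_add linear_scale)

lemma continuous_D: "continuous_on UNIV (D h)"
  using continuous_deriv[of h] unfolding D_def[abs_def] .

lemma continuous_\<phi>: "continuous_on UNIV \<phi>"
  using differentiable by (intro differentiable_imp_continuous_on) (simp add: differentiable_on_def)

lemma radius: obtains R where "0 < R" "\<And>x. R < norm x \<Longrightarrow> \<phi> x = 0" "\<And>h x. R < norm x \<Longrightarrow> D h x = 0"
proof -
  obtain R where R: "\<And>x. R < norm x \<Longrightarrow> \<phi> x = 0" using bounded_support by blast
  have "D h x = 0" if x: "R < norm x" for h x
  proof -
    have "open {x :: 'a. R < norm x}" by (intro open_Collect_less continuous_intros)
    have "(\<phi> has_derivative (\<lambda>_. 0)) (at x)"
      by (rule has_derivative_transform_within_open[of "\<lambda>_. 0", OF _ \<open>open {x :: 'a. R < norm x}\<close>])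
        (use R x in auto)
    then show ?thesis using fun_cong[OF has_derivative_unique[OF has_derivative_D[of x]]] by simp
  qed
  then show ?thesis using R by (intro that[of "max R 1"]) auto
qed

lemma integrable_\<phi>: "W \<in> sets borel \<Longrightarrow> integrable lborel (\<lambda>x. indicator W x * \<phi> x)"
proof -
  obtain R where "\<And>x. R < norm x \<Longrightarrow> \<phi> x = 0" by (rule radius) blast
  then show "W \<in> sets borel \<Longrightarrow> integrable lborel (\<lambda>x. indicator W x * \<phi> x)"
    by (rule integrable_indicator_compact_support[OF continuous_\<phi>])
qed

lemma integrable_D: "W \<in> sets borel \<Longrightarrow> integrable lborel (\<lambda>x. indicator W x * D h x)"
proof -
  obtain R where "\<And>x. R < norm x \<Longrightarrow> D h x = 0" by (rule radius) blast
  then show "W \<in> sets borel \<Longrightarrow> integrable lborel (\<lambda>x. indicator W x * D h x)"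
    by (rule integrable_indicator_compact_support[OF continuous_D])
qed

lemma DERIV_line: "((\<lambda>s. \<phi> (x + s *\<^sub>R h)) has_real_derivative D h (x + s *\<^sub>R h)) (at s)"
proof -
  have "((\<lambda>s. \<phi> (x + s *\<^sub>R h)) has_derivative (\<lambda>u. D (u *\<^sub>R h) (x + s *\<^sub>R h))) (at s)"
    by (rule has_derivative_compose[OF _ has_derivative_D]) (auto intro!: derivative_eq_intros)
  then show ?thesis by (simp add: has_field_derivative_def D_scale mult.commute[of _ "D h _"])
qed

lemma D_bounded: obtains M where "0 \<le> M" "\<And>x. \<bar>D h x\<bar> \<le> M"
proof -
  obtain R where R: "0 < R" "\<And>h x. R < norm x \<Longrightarrow> D h x = 0" by (rule radius) blast
  have "bounded (D h ` cball 0 R)"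
    by (intro compact_imp_bounded compact_continuous_image continuous_on_subset[OF continuous_D]) auto
  then obtain M where "\<forall>y\<in>D h ` cball 0 R. norm y \<le> M" unfolding bounded_iff by blast
  then have M: "\<bar>D h x\<bar> \<le> M" if "norm x \<le> R" for x using that by simp
  show ?thesis
  proof (rule that[of "max 0 M"])
    show "\<bar>D h x\<bar> \<le> max 0 M" for x using M[of x] R(2)[of x h] by (cases "norm x \<le> R") auto
  qed simp
qed

text \<open>Takes the place of integration by parts: an integral of a derivative over
  \<open>W\<close> becomes a limit of differences between integrals over translates of
  \<open>W\<close>, so that only the behaviour of \<open>W\<close> under translation matters. The
  mean value theorem and the support, enlarged by \<open>norm h\<close>, supply the dominating
  function.\<close>

lemma difference_quotient_integral:
  assumes W: "W \<in> sets borel"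
  shows "(\<lambda>i. \<integral>x. indicator W x * (real (Suc i) * (\<phi> (x + (1 / real (Suc i)) *\<^sub>R h) - \<phi> x)) \<partial>lborel)
    \<longlonglongrightarrow> (\<integral>x. indicator W x * D h x \<partial>lborel)"
proof -
  obtain R where R: "0 < R" "\<And>x. R < norm x \<Longrightarrow> \<phi> x = 0" by (rule radius) blast
  obtain M where M: "0 \<le> M" "\<And>x. \<bar>D h x\<bar> \<le> M" by (rule D_bounded[of h]) blast
  have W'[measurable]: "W \<in> sets lborel" using W by simp
  have [measurable]: "\<phi> \<in> borel_measurable borel" "D h \<in> borel_measurable borel"
    using continuous_\<phi> continuous_D by (auto intro: borel_measurable_continuous_onI)
  show ?thesis
  proof (rule integral_dominated_convergence[where w = "\<lambda>x. indicator (cball 0 (R + norm h)) x * M"])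
    have "integrable lborel (indicat_real (cball (0::'a) (R + norm h)))"
      using emeasure_lborel_cball_finite[of 0 "R + norm h"] by (intro integrable_real_indicator) auto
    then show "integrable lborel (\<lambda>x::'a. indicator (cball 0 (R + norm h)) x * M)" by simp
    show "AE x in lborel. (\<lambda>i. indicator W x * (real (Suc i) * (\<phi> (x + (1 / real (Suc i)) *\<^sub>R h) - \<phi> x)))
        \<longlonglongrightarrow> indicator W x * D h x"
    proof (rule AE_I2)
      fix x
      have "((\<lambda>s. (\<phi> (x + s *\<^sub>R h) - \<phi> x) / s) \<longlongrightarrow> D h x) (at 0)"
        using DERIV_line[of x h 0] by (simp add: DERIV_def)
      moreover have "filterlim (\<lambda>i. 1 / real (Suc i)) (at 0) sequentially"
        using LIMSEQ_Suc[OF lim_1_over_n] by (auto simp: filterlim_at)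
      ultimately have "(\<lambda>i. (\<phi> (x + (1 / real (Suc i)) *\<^sub>R h) - \<phi> x) / (1 / real (Suc i))) \<longlonglongrightarrow> D h x"
        by (rule filterlim_compose)
      then show "(\<lambda>i. indicator W x * (real (Suc i) * (\<phi> (x + (1 / real (Suc i)) *\<^sub>R h) - \<phi> x)))
          \<longlonglongrightarrow> indicator W x * D h x"
        by (intro tendsto_mult tendsto_const) (simp add: mult.commute)
    qed
    fix i
    show "AE x in lborel. norm (indicator W x * (real (Suc i) * (\<phi> (x + (1 / real (Suc i)) *\<^sub>R h) - \<phi> x)))
        \<le> indicator (cball 0 (R + norm h)) x * M"
    proof (rule AE_I2)
      fix x
      define s where "s = 1 / real (Suc i)"
      have s: "0 < s" "s \<le> 1" "real (Suc i) = 1 / s" by (auto simp: s_def)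
      show "norm (indicator W x * (real (Suc i) * (\<phi> (x + (1 / real (Suc i)) *\<^sub>R h) - \<phi> x)))
        \<le> indicator (cball 0 (R + norm h)) x * M"
      proof (cases "norm x \<le> R + norm h")
        case True
        obtain u where "\<phi> (x + s *\<^sub>R h) - \<phi> (x + 0 *\<^sub>R h) = (s - 0) * D h (x + u *\<^sub>R h)"
          using MVT2[OF s(1) DERIV_line] by blast
        then have "\<bar>real (Suc i) * (\<phi> (x + (1 / real (Suc i)) *\<^sub>R h) - \<phi> x)\<bar> \<le> M"
          using M(2)[of "x + u *\<^sub>R h"] s unfolding s_def[symmetric] by simp
        then show ?thesis using True M(1) by (auto simp: indicator_def)
      next
        case False
        have "norm (s *\<^sub>R h) \<le> norm h" using s by (simp add: mult_left_le_one_le)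
        then have "R < norm (x + s *\<^sub>R h)" "R < norm x"
          using False norm_triangle_ineq2[of x "- (s *\<^sub>R h)"] norm_ge_zero[of h]
          by (auto simp del: norm_scaleR norm_ge_zero)
        then show ?thesis using R(2) unfolding s_def[symmetric] by (auto simp: indicator_def M)
      qed
    qed
  qed measurable
qed

lemma integral_translate:
  assumes W: "W \<in> sets borel"
  shows "(\<integral>x. indicator W x * \<phi> (x + c) \<partial>lborel) = (\<integral>x. indicator W (x - c) * \<phi> x \<partial>lborel)"
    and "integrable lborel (\<lambda>x. indicator W x * \<phi> (x + c))"
proof -
  have [measurable]: "\<phi> \<in> borel_measurable borel"
    using continuous_\<phi> by (auto intro: borel_measurable_continuous_onI)
  note W[measurable]
  have "(\<integral>x. indicator W (x - c) * \<phi> x \<partial>lborel) = (\<integral>x. indicator W (x - c) * \<phi> x \<partial>(distr lborel borel ((+) c)))"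
    by (simp add: lborel_distr_plus)
  also have "\<dots> = (\<integral>x. indicator W x * \<phi> (x + c) \<partial>lborel)"
    by (subst integral_distr) (auto simp: add.commute)
  finally show "(\<integral>x. indicator W x * \<phi> (x + c) \<partial>lborel) = (\<integral>x. indicator W (x - c) * \<phi> x \<partial>lborel)" ..
  have "(\<lambda>x. x - c) -` W \<in> sets borel"
    by (rule measurable_sets_borel[OF _ W]) auto
  from integrable_\<phi>[OF this] have "integrable (distr lborel borel ((+) c)) (\<lambda>x. indicator W (x - c) * \<phi> x)"
    by (simp add: lborel_distr_plus indicator_vimage)
  then show "integrable lborel (\<lambda>x. indicator W x * \<phi> (x + c))"
    by (subst (asm) integrable_distr_eq) (auto simp: add.commute)
qed

lemma integral_difference_quotient:
  assumes W: "W \<in> sets borel"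
  shows "(\<integral>x. indicator W x * (k * (\<phi> (x + c) - \<phi> x)) \<partial>lborel)
      = k * ((\<integral>x. indicator W x * \<phi> (x + c) \<partial>lborel) - (\<integral>x. indicator W x * \<phi> x \<partial>lborel))"
proof -
  have "(\<lambda>x. indicator W x * (k * (\<phi> (x + c) - \<phi> x)))
      = (\<lambda>x. k * (indicator W x * \<phi> (x + c) - indicator W x * \<phi> x))"
    by (simp add: fun_eq_iff right_diff_distrib mult.left_commute)
  then show ?thesis
    by (simp only: integral_mult_right_zero
        Bochner_Integration.integral_diff[OF integral_translate(2)[OF W] integrable_\<phi>[OF W]])
qed

lemma integral_D_invariant:
  assumes W: "W \<in> sets borel" and inv: "\<And>x s. x + s *\<^sub>R h \<in> W \<longleftrightarrow> x \<in> W"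
  shows "(\<integral>x. indicator W x * D h x \<partial>lborel) = 0"
proof (rule LIMSEQ_unique[OF difference_quotient_integral[OF W]])
  have "(\<integral>x. indicator W x * (real (Suc i) * (\<phi> (x + (1 / real (Suc i)) *\<^sub>R h) - \<phi> x)) \<partial>lborel) = 0" for i
  proof -
    let ?c = "(1 / real (Suc i)) *\<^sub>R h"
    have "indicator W (x - ?c) = (indicator W x :: real)" for x
      using inv[of "x - ?c" "1 / real (Suc i)"] by (simp add: indicator_def)
    then have "(\<integral>x. indicator W x * \<phi> (x + ?c) \<partial>lborel) = (\<integral>x. indicator W x * \<phi> x \<partial>lborel)"
      by (simp only: integral_translate[OF W])
    moreover have "(\<integral>x. indicator W x * (real (Suc i) * (\<phi> (x + ?c) - \<phi> x)) \<partial>lborel)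
        = real (Suc i) * ((\<integral>x. indicator W x * \<phi> (x + ?c) \<partial>lborel) - (\<integral>x. indicator W x * \<phi> x \<partial>lborel))"
      by (rule integral_difference_quotient[OF W])
    ultimately show ?thesis by simp
  qed
  then show "(\<lambda>i. \<integral>x. indicator W x * (real (Suc i) * (\<phi> (x + (1 / real (Suc i)) *\<^sub>R h) - \<phi> x)) \<partial>lborel) \<longlonglongrightarrow> 0"
    by simp
qed

text \<open>The translate of \<open>W\<close> by a positive multiple of \<open>h\<close> contains
  \<open>W\<close>, so each difference quotient has a nonnegative integral. Applied to the
  half-space below a shock, this makes the trace on the shock nonnegative.\<close>

lemma integral_D_nonneg:
  assumes W: "W \<in> sets borel" and inv: "\<And>x s. 0 \<le> s \<Longrightarrow> x + s *\<^sub>R h \<in> W \<Longrightarrow> x \<in> W"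
    and pos: "\<And>x. 0 \<le> \<phi> x"
  shows "0 \<le> (\<integral>x. indicator W x * D h x \<partial>lborel)"
proof (rule LIMSEQ_le_const[OF difference_quotient_integral[OF W]])
  have "0 \<le> (\<integral>x. indicator W x * (real (Suc i) * (\<phi> (x + (1 / real (Suc i)) *\<^sub>R h) - \<phi> x)) \<partial>lborel)" for i
  proof -
    let ?c = "(1 / real (Suc i)) *\<^sub>R h"
    have sub: "(\<lambda>x. x - ?c) -` W \<in> sets borel"
      by (rule measurable_sets_borel[OF _ W]) auto
    have "indicator W x * \<phi> x \<le> indicator W (x - ?c) * \<phi> x" for x
      using inv[of "1 / real (Suc i)" "x - ?c"] pos[of x] by (auto simp: indicator_def)
    then have "(\<integral>x. indicator W x * \<phi> x \<partial>lborel) \<le> (\<integral>x. indicator W x * \<phi> (x + ?c) \<partial>lborel)"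
      unfolding integral_translate(1)[OF W]
      using integrable_\<phi>[OF W] integrable_\<phi>[OF sub] by (intro integral_mono) (auto simp: indicator_vimage)
    moreover have "(\<integral>x. indicator W x * (real (Suc i) * (\<phi> (x + ?c) - \<phi> x)) \<partial>lborel)
        = real (Suc i) * ((\<integral>x. indicator W x * \<phi> (x + ?c) \<partial>lborel) - (\<integral>x. indicator W x * \<phi> x \<partial>lborel))"
      by (rule integral_difference_quotient[OF W])
    ultimately show ?thesis by simp
  qed
  then show "\<exists>N. \<forall>i\<ge>N. 0 \<le> (\<integral>x. indicator W x * (real (Suc i) * (\<phi> (x + (1 / real (Suc i)) *\<^sub>R h) - \<phi> x)) \<partial>lborel)"
    by blast
qed

end

context compactly_supported_C1
begin

lemma integral_half_line:
  assumes k: "k \<noteq> 0"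
  shows "(\<integral>s. indicator {0..} s * D k (x + s *\<^sub>R k) \<partial>lborel) = - \<phi> x"
proof -
  obtain R where R: "0 < R" "\<And>x. R < norm x \<Longrightarrow> \<phi> x = 0" "\<And>h x. R < norm x \<Longrightarrow> D h x = 0"
    by (rule radius) blast
  define S where "S = (R + norm x + 1) / norm k"
  have far: "R < norm (x + s *\<^sub>R k)" if "S \<le> s" for s
  proof -
    have "0 \<le> S" using R by (simp add: S_def)
    have "R + norm x + 1 \<le> s * norm k" using that k by (simp add: S_def field_simps)
    also have "\<dots> = norm (s *\<^sub>R k)" using that \<open>0 \<le> S\<close> by simp
    finally show ?thesis using norm_triangle_ineq2[of "s *\<^sub>R k" "- x"] by (simp add: add.commute)
  qed
  have S: "0 \<le> S" using R by (simp add: S_def)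
  have "(\<integral>s. indicator {0..} s * D k (x + s *\<^sub>R k) \<partial>lborel)
      = (\<integral>s. indicator {0..S} s *\<^sub>R D k (x + s *\<^sub>R k) \<partial>lborel)"
    using R(3) far by (intro Bochner_Integration.integral_cong) (auto simp: indicator_def)
  also have "\<dots> = \<phi> (x + S *\<^sub>R k) - \<phi> (x + 0 *\<^sub>R k)"
  proof (rule integral_FTC_atLeastAtMost[OF S])
    show "((\<lambda>s. \<phi> (x + s *\<^sub>R k)) has_vector_derivative D k (x + s *\<^sub>R k)) (at s within {0..S})" for s
      using DERIV_line[of x k s]
      by (simp add: has_real_derivative_iff_has_vector_derivative has_vector_derivative_at_within)
    show "continuous_on {0..S} (\<lambda>s. D k (x + s *\<^sub>R k))"
      by (intro continuous_on_compose2[OF continuous_D] continuous_intros) auto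
  qed
  finally show ?thesis using R(2)[OF far[of S]] by simp
qed

end

text \<open>In coordinates moving with velocity \<open>h\<close> the region is a half-cylinder over
  \<open>A\<close> and the derivative along \<open>(1, h)\<close> is the time derivative;
  integrating in time leaves the initial trace.\<close>

lemma integral_transport_derivative:
  fixes \<phi> :: "real \<times> 'b::euclidean_space \<Rightarrow> real"
  assumes \<phi>: "compactly_supported_C1 \<phi>" and A[measurable]: "A \<in> sets borel"
  shows "(\<integral>z. indicator {z. 0 \<le> fst z \<and> snd z - fst z *\<^sub>R h \<in> A} z
      * compactly_supported_C1.D \<phi> (1, h) z \<partial>lborel) = - (\<integral>x. indicator A x * \<phi> (0, x) \<partial>lborel)"
proof -
  interpret compactly_supported_C1 \<phi> by (rule \<phi>)
  define E where "E = {z :: real \<times> 'b. 0 \<le> fst z \<and> snd z - fst z *\<^sub>R h \<in> A}"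
  let ?\<sigma> = "\<lambda>(t::real, x). (t, x + t *\<^sub>R h)"
  have [measurable]: "?\<sigma> \<in> borel \<rightarrow>\<^sub>M borel"
    by (intro borel_measurable_continuous_onI) (auto simp: case_prod_unfold intro!: continuous_intros)
  have E[measurable]: "E \<in> sets borel"
  proof -
    have "{z :: real \<times> 'b. 0 \<le> fst z} \<in> sets borel"
      by (intro borel_closed closed_Collect_le continuous_intros)
    moreover have "(\<lambda>z :: real \<times> 'b. snd z - fst z *\<^sub>R h) -` A \<in> sets borel"
      by (rule measurable_sets_borel[OF _ A], intro borel_measurable_continuous_onI continuous_intros)
    ultimately have "{z :: real \<times> 'b. 0 \<le> fst z} \<inter> (\<lambda>z. snd z - fst z *\<^sub>R h) -` A \<in> sets borel" by blast
    then show ?thesis by (simp add: E_def vimage_def Collect_conj_eq)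
  qed
  have [measurable]: "D (1, h) \<in> borel_measurable borel"
    using continuous_D by (auto intro: borel_measurable_continuous_onI)
  define g where "g z = indicator E z * D (1, h) z" for z
  have [measurable]: "g \<in> borel_measurable borel" unfolding g_def[abs_def] by measurable
  define f where "f t x = indicator {0..} t * (indicator A x * D (1, h) ((0, x) + t *\<^sub>R (1, h)))" for t :: real and x
  have gf: "g (?\<sigma> z) = case_prod f z" for z
    by (auto simp: g_def f_def E_def indicator_def split: prod.split)
  have "integrable (distr lborel borel ?\<sigma>) g"
    unfolding lborel_shear g_def[abs_def] by (rule integrable_D[OF E])
  then have "integrable lborel (\<lambda>z. g (?\<sigma> z))" by (subst (asm) integrable_distr_eq) auto
  then have int: "integrable (lborel \<Otimes>\<^sub>M lborel) (case_prod f)"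
    unfolding lborel_prod gf .
  have "(\<integral>z. g z \<partial>lborel) = (\<integral>z. g z \<partial>(distr lborel borel ?\<sigma>))" unfolding lborel_shear ..
  also have "\<dots> = (\<integral>z. g (?\<sigma> z) \<partial>lborel)" by (subst integral_distr) auto
  also have "\<dots> = integral\<^sup>L (lborel \<Otimes>\<^sub>M lborel) (case_prod f)" unfolding gf lborel_prod ..
  also have "\<dots> = (\<integral>x. (\<integral>t. f t x \<partial>lborel) \<partial>lborel)"
    by (rule lborel_pair.integral_snd[OF int, symmetric])
  also have "\<dots> = (\<integral>x. - (indicator A x * \<phi> (0, x)) \<partial>lborel)"
  proof (rule Bochner_Integration.integral_cong)
    fix x
    have "(\<integral>t. f t x \<partial>lborel)
        = indicator A x * (\<integral>t. indicator {0..} t * D (1, h) ((0, x) + t *\<^sub>R (1, h)) \<partial>lborel)"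
      unfolding f_def by (subst mult.left_commute) (rule integral_mult_right_zero)
    also have "\<dots> = - (indicator A x * \<phi> (0, x))"
      by (subst integral_half_line) (auto simp: zero_prod_def)
    finally show "(\<integral>t. f t x \<partial>lborel) = - (indicator A x * \<phi> (0, x))" .
  qed simp
  also have "\<dots> = - (\<integral>x. indicator A x * \<phi> (0, x) \<partial>lborel)" by simp
  finally show ?thesis unfolding g_def E_def .
qed

lemma test_function_C1:
  assumes "test_function \<phi>" shows "compactly_supported_C1 \<phi>"
proof
  have ck: "Ck (Suc 0) \<phi>" and c: "compact (closure {z. \<phi> z \<noteq> 0})"
    using assms by (auto simp: test_function_def)
  show "\<phi> differentiable at x" "continuous_on UNIV (\<lambda>x. frechet_derivative \<phi> (at x) h)" for x h
    using ck by simp_all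
  obtain R where "\<And>z. \<phi> z \<noteq> 0 \<Longrightarrow> norm z \<le> R"
    using compact_imp_bounded[OF c] closure_subset[of "{z. \<phi> z \<noteq> 0}"] unfolding bounded_iff by blast
  then show "\<exists>R. \<forall>x. R < norm x \<longrightarrow> \<phi> x = 0" by (metis not_le)
qed

section \<open>Piecewise constant fields with two interfaces\<close>

text \<open>Polymorphic, so that density, velocity and every flux built from them have this one
  form. The default \<open>xp\<close> on the interfaces and for \<open>t \<le> 0\<close> copies the
  two shock fields, which makes them equal to a \<open>step\<close> at every point.\<close>

definition step :: "real \<Rightarrow> real \<Rightarrow> 'b \<Rightarrow> 'b \<Rightarrow> 'b \<Rightarrow> spacetime \<Rightarrow> 'b" where
  "step \<nu> \<mu> xm x1 xp z =
     (if 0 < fst z \<and> snd z $ 2 < \<nu> * fst z then xm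
      else if 0 < fst z \<and> \<nu> * fst z < snd z $ 2 \<and> snd z $ 2 < \<mu> * fst z then x1 else xp)"

lemma step_comp: "f (step \<nu> \<mu> xm x1 xp z) = step \<nu> \<mu> (f xm) (f x1) (f xp) z"
  and step_comp2: "g (step \<nu> \<mu> xm x1 xp z) (step \<nu> \<mu> ym y1 yp z) = step \<nu> \<mu> (g xm ym) (g x1 y1) (g xp yp) z"
  by (auto simp: step_def)

lemma step_measurable[measurable]: "step \<nu> \<mu> xm x1 xp \<in> borel_measurable borel"
proof -
  have [measurable]: "{z :: spacetime. 0 < fst z \<and> snd z $ 2 < \<nu> * fst z} \<in> sets borel"
    "{z :: spacetime. 0 < fst z \<and> \<nu> * fst z < snd z $ 2 \<and> snd z $ 2 < \<mu> * fst z} \<in> sets borel"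
    by (intro borel_open open_Collect_conj open_Collect_less continuous_intros)+
  have eq: "step \<nu> \<mu> xm x1 xp = (\<lambda>z. if z \<in> {z :: spacetime. 0 < fst z \<and> snd z $ 2 < \<nu> * fst z} then xm else
      if z \<in> {z :: spacetime. 0 < fst z \<and> \<nu> * fst z < snd z $ 2 \<and> snd z $ 2 < \<mu> * fst z} then x1 else xp)"
    by (simp add: fun_eq_iff step_def)
  show ?thesis unfolding eq by measurable
qed

lemma loc_integrable_step:
  fixes xm x1 xp :: "'b::{banach, second_countable_topology}"
  shows "loc_integrable (step \<nu> \<mu> xm x1 xp)"
  unfolding loc_integrable_def set_integrable_def
proof (intro allI impI)
  fix K :: "spacetime set" assume K: "compact K \<and> K \<subseteq> slab"
  then have [measurable]: "K \<in> sets borel" by (auto intro: borel_closed compact_imp_closed)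
  have "emeasure lborel K < \<infinity>" using emeasure_compact_finite[of K] K by simp
  then have "integrable lborel (\<lambda>z. indicat_real K z * (norm xm + norm x1 + norm xp))"
    by (intro integrable_mult_left integrable_real_indicator) auto
  then have "integrable lborel (\<lambda>z. indicat_real K z *\<^sub>R step \<nu> \<mu> xm x1 xp z)"
  proof (rule Bochner_Integration.integrable_bound)
    show "(\<lambda>z. indicat_real K z *\<^sub>R step \<nu> \<mu> xm x1 xp z) \<in> borel_measurable lborel" by measurable
  qed (auto simp: step_def indicator_def)
  then show "integrable lebesgue (\<lambda>z. indicat_real K z *\<^sub>R step \<nu> \<mu> xm x1 xp z)"
    by (subst integrable_completion) auto
qed

lemma slab_measurable[measurable]: "slab \<in> sets borel"
  by (simp add: slab_def closed_Times)

lemma slab_wedge_eq: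
  "slab \<inter> wedge \<kappa> = {z. 0 \<le> fst z \<and> snd z - fst z *\<^sub>R (\<kappa> *\<^sub>R axis 2 1) \<in> {x. x $ 2 < 0}}"
  by (auto simp: slab_def wedge_def algebra_simps)

text \<open>Integrating out the second space coordinate leaves the values of \<open>\<phi>\<close>
  on the line. The volume form avoids a surface measure.\<close>

definition trace_functional :: "(spacetime \<Rightarrow> real) \<Rightarrow> real \<Rightarrow> real" where
  "trace_functional \<phi> \<kappa> =
     (\<integral>z. indicator (slab \<inter> wedge \<kappa>) z * frechet_derivative \<phi> (at z) (0, axis 2 1) \<partial>lborel)"

lemma trace_functional_nonneg:
  assumes \<phi>: "compactly_supported_C1 \<phi>" and pos: "\<And>z. 0 \<le> \<phi> z"
  shows "0 \<le> trace_functional \<phi> \<kappa>"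
proof -
  interpret compactly_supported_C1 \<phi> by (rule \<phi>)
  show ?thesis unfolding trace_functional_def D_def[symmetric]
  proof (rule integral_D_nonneg[OF _ _ pos])
    show "slab \<inter> wedge \<kappa> \<in> sets borel" by auto
  qed (auto simp: slab_def wedge_def)
qed

text \<open>The trace functional is the integral of the test function along the shock; its coefficients
  are the defects in the Rankine-Hugoniot conditions.\<close>

lemma weak_pairing_step:
  fixes wm w1 wp :: real and Fm F1 Fp :: "real^2"
  assumes t: "test_function \<phi>" and lt: "\<nu> < \<mu>"
  shows "weak_pairing (step \<nu> \<mu> wm w1 wp) (step \<nu> \<mu> Fm F1 Fp) (\<lambda>x. if x $ 2 < 0 then wm else wp) \<phi>
    = ((Fm - F1) $ 2 - \<nu> * (wm - w1)) * trace_functional \<phi> \<nu>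
    + ((F1 - Fp) $ 2 - \<mu> * (w1 - wp)) * trace_functional \<phi> \<mu>"
proof -
  interpret compactly_supported_C1 \<phi> by (rule test_function_C1[OF t])
  let ?e1 = "(0, axis 1 1) :: spacetime" and ?e2 = "(0, axis 2 1) :: spacetime"
  let ?et = "(1, 0) :: spacetime"
  have [measurable]: "D h \<in> borel_measurable borel" for h
    by (rule borel_measurable_continuous_onI[OF continuous_D])
  have dt: "dt \<phi> = D ?et" by (simp add: dt_def D_def fun_eq_iff)
  have grad: "F \<bullet> grad \<phi> z = F $ 1 * D ?e1 z + F $ 2 * D ?e2 z" for F z
    by (simp add: grad_def D_def inner_vec_def sum_2)
  define \<phi>0 where "\<phi>0 x = \<phi> (0, x)" for x
  define H where "H = {x :: real^2. x $ 2 < 0}"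
  have Hm[measurable]: "H \<in> sets borel"
    unfolding H_def by (intro borel_open open_Collect_less continuous_intros)
  define I where "I = (\<integral>x. indicator H x * \<phi>0 x \<partial>lborel)"
  define J where "J = (\<integral>x. \<phi>0 x \<partial>lborel)"
  obtain R where R: "\<And>x. R < norm x \<Longrightarrow> \<phi> x = 0" by (rule radius) blast
  have c0: "continuous_on UNIV \<phi>0" unfolding \<phi>0_def
    by (intro continuous_on_compose2[OF continuous_\<phi>] continuous_intros) auto
  have [measurable]: "\<phi>0 \<in> borel_measurable borel" using c0 by (rule borel_measurable_continuous_onI)
  have int0: "integrable lborel (\<lambda>x. indicator A x * \<phi>0 x)" if "A \<in> sets borel" for A
    by (rule integrable_indicator_compact_support[OF c0 _ that, of R]) (simp add: \<phi>0_def R)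
  have int0': "integrable lborel \<phi>0" using int0[of UNIV] by simp
  define G where "G = trace_functional \<phi>"
  define T where "T W = (\<integral>z. indicator (slab \<inter> W) z * D ?et z \<partial>lborel)" for W
  define X where "X W = (\<integral>z. indicator (slab \<inter> W) z * D ?e1 z \<partial>lborel)" for W
  define Y where "Y W = (\<integral>z. indicator (slab \<inter> W) z * D ?e2 z \<partial>lborel)" for W
  have intD: "integrable lborel (\<lambda>z. indicator (slab \<inter> W) z * D h z)" if "W \<in> sets borel" for W h
    using that by (intro integrable_D) auto
  have Y1: "Y (wedge \<kappa>) = G \<kappa>" for \<kappa> by (simp add: Y_def G_def trace_functional_def D_def)
  have sl: "slab \<inter> W \<in> sets borel" if "W \<in> sets borel" for W using that by auto
  have Y0: "Y UNIV = 0" unfolding Y_def by (rule integral_D_invariant[OF sl]) (auto simp: slab_def)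
  have X0: "X UNIV = 0" unfolding X_def by (rule integral_D_invariant[OF sl]) (auto simp: slab_def)
  have X1: "X (wedge \<kappa>) = 0" for \<kappa>
    unfolding X_def
    by (rule integral_D_invariant[OF sl[OF wedge_measurable]]) (auto simp: slab_def wedge_def axis_def)
  have "slab \<inter> UNIV = {z :: spacetime. 0 \<le> fst z \<and> snd z - fst z *\<^sub>R 0 \<in> UNIV}" by (auto simp: slab_def)
  then have T0: "T UNIV = - J"
    using integral_transport_derivative[OF compactly_supported_C1_axioms, of UNIV 0]
    by (simp add: T_def J_def \<phi>0_def[symmetric] zero_prod_def[symmetric] del: Int_UNIV_right)
  have T1: "T (wedge \<kappa>) = - I - \<kappa> * G \<kappa>" for \<kappa>
  proof -
    \<comment> \<open>The half-space below the shock is carried along by the velocity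
      \<open>\<kappa>\<close> in the second direction. Splitting the transport derivative trades its
      time part for the initial trace and the trace on the shock.\<close>
    have "D (1, \<kappa> *\<^sub>R axis 2 1) z = D ?et z + \<kappa> * D ?e2 z" for z
      using D_add[of ?et "\<kappa> *\<^sub>R ?e2" z] by (simp add: D_scale[symmetric])
    then have "- I = (\<integral>z. indicator (slab \<inter> wedge \<kappa>) z * D ?et z
        + \<kappa> * (indicator (slab \<inter> wedge \<kappa>) z * D ?e2 z) \<partial>lborel)"
      using integral_transport_derivative[OF compactly_supported_C1_axioms Hm, of "\<kappa> *\<^sub>R axis 2 1"]
      unfolding H_def slab_wedge_eq[symmetric] I_def \<phi>0_def by (simp add: algebra_simps)
    also have "\<dots> = T (wedge \<kappa>) + \<kappa> * G \<kappa>"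
      unfolding Y1[symmetric] T_def Y_def using intD[OF wedge_measurable]
      by (subst Bochner_Integration.integral_add) auto
    finally show ?thesis by simp
  qed
  have K: "(\<integral>z. indicator (slab \<inter> W) z * (c * D ?et z + (a1 * D ?e1 z + a2 * D ?e2 z)) \<partial>lborel)
      = c * T W + (a1 * X W + a2 * Y W)"
    and Ki: "integrable lborel (\<lambda>z. indicator (slab \<inter> W) z * (c * D ?et z + (a1 * D ?e1 z + a2 * D ?e2 z)))"
    if W: "W \<in> sets borel" for W c a1 a2
  proof -
    have eq: "(\<lambda>z. indicator (slab \<inter> W) z * (c * D ?et z + (a1 * D ?e1 z + a2 * D ?e2 z)))
      = (\<lambda>z. c * (indicator (slab \<inter> W) z * D ?et z) + (a1 * (indicator (slab \<inter> W) z * D ?e1 z)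
          + a2 * (indicator (slab \<inter> W) z * D ?e2 z)))"
      by (simp add: fun_eq_iff distrib_left mult.left_commute)
    have i: "integrable lborel (\<lambda>z. k * (indicator (slab \<inter> W) z * D h z))" for k h
      using intD[OF W] by simp
    show "(\<integral>z. indicator (slab \<inter> W) z * (c * D ?et z + (a1 * D ?e1 z + a2 * D ?e2 z)) \<partial>lborel)
      = c * T W + (a1 * X W + a2 * Y W)"
      unfolding eq T_def X_def Y_def
      by (simp only: Bochner_Integration.integral_add[OF i Bochner_Integration.integrable_add[OF i i]]
          Bochner_Integration.integral_add[OF i i] integral_mult_right_zero)
    show "integrable lborel (\<lambda>z. indicator (slab \<inter> W) z * (c * D ?et z + (a1 * D ?e1 z + a2 * D ?e2 z)))"
      unfolding eq by (intro Bochner_Integration.integrable_add i)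
  qed
  define k where "k W c a z = indicator (slab \<inter> W) z * (c * D ?et z + (a $ 1 * D ?e1 z + a $ 2 * D ?e2 z))"
    for W c z and a :: "real^2"
  have km: "integrable lborel (k W c a)" if "W \<in> sets borel" for W c a
    unfolding k_def[abs_def] by (rule Ki[OF that])
  have kI: "integral\<^sup>L lborel (k W c a) = c * T W + (a $ 1 * X W + a $ 2 * Y W)" if "W \<in> sets borel" for W c a
    unfolding k_def[abs_def] by (rule K[OF that])
  have U: "UNIV \<in> sets (borel :: spacetime measure)" by simp
  have W[simp]: "wedge \<kappa> \<in> sets borel" for \<kappa> by measurable
  have "set_lebesgue_integral lebesgue slab (\<lambda>z. step \<nu> \<mu> wm w1 wp z * dt \<phi> z + step \<nu> \<mu> Fm F1 Fp z \<bullet> grad \<phi> z)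
      = (\<integral>z. indicator slab z * (step \<nu> \<mu> wm w1 wp z * D ?et z
          + (step \<nu> \<mu> Fm F1 Fp z $ 1 * D ?e1 z + step \<nu> \<mu> Fm F1 Fp z $ 2 * D ?e2 z)) \<partial>lborel)"
    unfolding set_lebesgue_integral_def dt grad step_comp[where f = "\<lambda>x. x $ 1"] step_comp[where f = "\<lambda>x. x $ 2"]
    by (subst integral_completion) auto
  \<comment> \<open>Telescoping: the upper state everywhere, plus one jump below the upper
    interface, plus another below the lower one.\<close>
  also have "\<dots> = (\<integral>z. k UNIV wp Fp z + (k (wedge \<mu>) (w1 - wp) (F1 - Fp) z
      + k (wedge \<nu>) (wm - w1) (Fm - F1) z) \<partial>lborel)"
  proof (rule integral_cong_AE)
    show "(\<lambda>z. indicator slab z * (step \<nu> \<mu> wm w1 wp z * D ?et z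
          + (step \<nu> \<mu> Fm F1 Fp z $ 1 * D ?e1 z + step \<nu> \<mu> Fm F1 Fp z $ 2 * D ?e2 z))) \<in> borel_measurable lborel"
      unfolding step_comp[where f = "\<lambda>x. x $ 1"] step_comp[where f = "\<lambda>x. x $ 2"] by measurable
    show "(\<lambda>z. k UNIV wp Fp z + (k (wedge \<mu>) (w1 - wp) (F1 - Fp) z
      + k (wedge \<nu>) (wm - w1) (Fm - F1) z)) \<in> borel_measurable lborel"
      by (intro borel_measurable_add borel_measurable_integrable km) auto
    show "AE z in lborel. indicator slab z * (step \<nu> \<mu> wm w1 wp z * D ?et z
          + (step \<nu> \<mu> Fm F1 Fp z $ 1 * D ?e1 z + step \<nu> \<mu> Fm F1 Fp z $ 2 * D ?e2 z))
       = k UNIV wp Fp z + (k (wedge \<mu>) (w1 - wp) (F1 - Fp) z + k (wedge \<nu>) (wm - w1) (Fm - F1) z)"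
      using AE_time_nonzero AE_shock_line[of \<nu>]
    proof eventually_elim
      case (elim z)
      show ?case
      proof (cases "z \<in> slab")
        case True
        then have t: "0 < fst z" using elim(1) by (auto simp: slab_def)
        then have "\<nu> * fst z < \<mu> * fst z" using lt by simp
        then consider "z \<in> wedge \<nu>" "z \<in> wedge \<mu>" "\<And>(x::real) y w. step \<nu> \<mu> x y w z = x" "\<And>(x::real^2) y w. step \<nu> \<mu> x y w z = x"
          | "z \<notin> wedge \<nu>" "z \<in> wedge \<mu>" "\<And>(x::real) y w. step \<nu> \<mu> x y w z = y" "\<And>(x::real^2) y w. step \<nu> \<mu> x y w z = y"
          | "z \<notin> wedge \<nu>" "z \<notin> wedge \<mu>" "\<And>(x::real) y w. step \<nu> \<mu> x y w z = w" "\<And>(x::real^2) y w. step \<nu> \<mu> x y w z = w"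
          using t elim(2) unfolding step_def wedge_def mem_Collect_eq
          by (cases "snd z $ 2 < \<nu> * fst z"; cases "snd z $ 2 < \<mu> * fst z") auto
        then show ?thesis
          using True by cases (simp_all add: k_def algebra_simps)
      qed (simp add: k_def)
    qed
  qed
  also have "\<dots> = wp * T UNIV + ((w1 - wp) * T (wedge \<mu>) + (F1 - Fp) $ 2 * G \<mu>
      + ((wm - w1) * T (wedge \<nu>) + (Fm - F1) $ 2 * G \<nu>))"
    by (simp only: Bochner_Integration.integral_add km kI W U
        Bochner_Integration.integrable_add X0 X1 Y0 Y1 mult_zero_right add_0 add_0_right)
  finally have A: "set_lebesgue_integral lebesgue slab
      (\<lambda>z. step \<nu> \<mu> wm w1 wp z * dt \<phi> z + step \<nu> \<mu> Fm F1 Fp z \<bullet> grad \<phi> z) = \<dots>" .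
  have "(LINT x|lebesgue. (if x $ 2 < 0 then wm else wp) * \<phi> (0, x))
      = (\<integral>x. wp * \<phi>0 x + (wm - wp) * (indicator H x * \<phi>0 x) \<partial>lebesgue)"
    by (intro Bochner_Integration.integral_cong) (auto simp: H_def \<phi>0_def algebra_simps)
  also have "\<dots> = (\<integral>x. wp * \<phi>0 x + (wm - wp) * (indicator H x * \<phi>0 x) \<partial>lborel)"
    by (rule integral_completion) simp
  also have "\<dots> = wp * J + (wm - wp) * I"
    unfolding I_def J_def using int0[OF Hm] int0' by simp
  finally have B: "(LINT x|lebesgue. (if x $ 2 < 0 then wm else wp) * \<phi> (0, x)) = wp * J + (wm - wp) * I" .
  show ?thesis unfolding weak_pairing_def A B T0 T1 G_def[symmetric] by (simp add: algebra_simps)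
qed

section \<open>The two shock solution\<close>

text \<open>For quadratic pressure, the velocity jump across a shock joining densities
  \<open>a < r\<close> is \<open>(r - a) * shock_slope a r\<close>, and
  \<open>a * shock_slope a r\<close> is the speed of the shock relative to the state of density
  \<open>r\<close>.\<close>

definition shock_slope :: "real \<Rightarrow> real \<Rightarrow> real" where
  "shock_slope a r = sqrt ((r + a) / (a * r))"

lemma shock_slope_sq:
  assumes "0 < a" "0 < r" shows "a * r * (shock_slope a r)\<^sup>2 = r + a" "0 < shock_slope a r"
  using assms by (simp_all add: shock_slope_def)

text \<open>Rankine-Hugoniot fixes \<open>x\<close> and \<open>y\<close> only up to sign. The side
  with the larger outer density has the larger relative speed but the smaller velocity jump: the
  ordering of the shocks therefore decides the sign of \<open>x\<close>, and the ordering of the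
  data velocities that of \<open>y\<close>.\<close>

lemma relative_velocity_signs:
  fixes a b r x y :: real
  assumes "0 < b" "b \<le> a" "a < r" and x: "r * x\<^sup>2 = a * (r + a)" and y: "r * y\<^sup>2 = b * (r + b)"
    and xy: "0 < x + y" and v: "0 < x * (r - a) / a + y * (r - b) / b"
  shows "0 < x" "0 < y"
proof -
  have "b * (r + b) \<le> a * (r + a)" using assms by (intro mult_mono) auto
  then have "r * y\<^sup>2 \<le> r * x\<^sup>2" using x y by simp
  moreover have "0 < r" using assms by linarith
  ultimately have yx: "y\<^sup>2 \<le> x\<^sup>2" by simp
  show "0 < x"
  proof (rule ccontr)
    assume "\<not> 0 < x"
    then have "(- x)\<^sup>2 < y\<^sup>2" using xy by (intro power_strict_mono) auto
    then show False using yx by simp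
  qed
  show "0 < y"
  proof (rule ccontr)
    assume "\<not> 0 < y"
    then have "y * (r - b) / b \<le> 0" using assms by (intro divide_nonpos_pos mult_nonpos_nonneg) auto
    then have "(- (y * (r - b) / b))\<^sup>2 < (x * (r - a) / a)\<^sup>2"
      using v by (intro power_strict_mono) auto
    then have "r * (y * (r - b) / b)\<^sup>2 < r * (x * (r - a) / a)\<^sup>2" using assms by simp
    also have "r * (y * (r - b) / b)\<^sup>2 = (r * y\<^sup>2) * (r - b)\<^sup>2 / b\<^sup>2"
      by (simp add: power_mult_distrib power_divide)
    also have "\<dots> = (r / b + 1) * (r - b)\<^sup>2"
      unfolding y using assms by (simp add: power2_eq_square field_simps)
    also have "r * (x * (r - a) / a)\<^sup>2 = (r * x\<^sup>2) * (r - a)\<^sup>2 / a\<^sup>2"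
      by (simp add: power_mult_distrib power_divide)
    also have "\<dots> = (r / a + 1) * (r - a)\<^sup>2"
      unfolding x using assms by (simp add: power2_eq_square field_simps)
    also have "\<dots> \<le> (r / b + 1) * (r - b)\<^sup>2"
      using assms by (intro mult_mono add_right_mono divide_left_mono power_mono) auto
    finally show False by simp
  qed
qed

text \<open>With \<open>e = 0\<close> the fan equations are the Rankine-Hugoniot conditions of two
  shocks. The last two conclusions say that the middle state lies between them in velocity, which
  later gives the sign of the energy dissipation.\<close>

lemma fan_equations_eps_zero:
  assumes f: "fan_equations d r m n \<beta> 0"
    and r: "0 < rho_minus d" "0 < rho_plus d" "rho_max d < r" and v: "vb_plus d < vb_minus d"
  shows "\<beta> = vb_minus d - (r - rho_minus d) * shock_slope (rho_minus d) r"
    and "\<beta> = vb_plus d + (r - rho_plus d) * shock_slope (rho_plus d) r"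
    and "m < \<beta>" "\<beta> < n"
proof -
  define a b where ab: "a = rho_minus d" "b = rho_plus d"
  define x y where "x = \<beta> - m" and "y = n - \<beta>"
  have pos: "0 < a" "0 < b" "a < r" "b < r" using r by (auto simp: ab rho_max_def)
  have rh: "m * (a - r) = a * vb_minus d - r * \<beta>" "n * (b - r) = b * vb_plus d - r * \<beta>"
    "m * (a * vb_minus d - r * \<beta>) = a * (vb_minus d)\<^sup>2 + a\<^sup>2 - r * \<beta>\<^sup>2 - r\<^sup>2"
    "n * (b * vb_plus d - r * \<beta>) = b * (vb_plus d)\<^sup>2 + b\<^sup>2 - r * \<beta>\<^sup>2 - r\<^sup>2"
    using f by (auto simp: fan_equations_def pressure_def ab)
  have v1: "a * (vb_minus d - \<beta>) = x * (r - a)" "b * (\<beta> - vb_plus d) = y * (r - b)"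
    using rh(1,2) by (auto simp: x_def y_def algebra_simps)
  have "(r - a) * (r * x\<^sup>2) = (r - a) * (a * (r + a))"
    using rh(1,3) unfolding x_def by algebra
  then have x2: "r * x\<^sup>2 = a * (r + a)" using pos by simp
  have "(r - b) * (r * y\<^sup>2) = (r - b) * (b * (r + b))"
    using rh(2,4) unfolding y_def by algebra
  then have y2: "r * y\<^sup>2 = b * (r + b)" using pos by simp
  have v2: "vb_minus d - \<beta> = x * (r - a) / a" "\<beta> - vb_plus d = y * (r - b) / b"
    using v1 pos by (auto simp: field_simps)
  have sum: "0 < x + y" "0 < x * (r - a) / a + y * (r - b) / b"
    using f v unfolding v2[symmetric] by (auto simp: fan_equations_def x_def y_def)
  have sg: "0 < x" "0 < y"
    using relative_velocity_signs[of b a r x y] relative_velocity_signs[of a b r y x] pos x2 y2 sum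
    by (cases "b \<le> a"; simp add: add.commute)+
  then show "m < \<beta>" "\<beta> < n" by (auto simp: x_def y_def)
  have "shock_slope a r = x / a" unfolding shock_slope_def
    by (rule real_sqrt_unique) (use x2 pos sg in \<open>auto simp: field_simps power2_eq_square\<close>)
  then show "\<beta> = vb_minus d - (r - rho_minus d) * shock_slope (rho_minus d) r"
    using v2 by (simp add: ab algebra_simps)
  have "shock_slope b r = y / b" unfolding shock_slope_def
    by (rule real_sqrt_unique) (use y2 pos sg in \<open>auto simp: field_simps power2_eq_square\<close>)
  then show "\<beta> = vb_plus d + (r - rho_plus d) * shock_slope (rho_plus d) r"
    using v2 by (simp add: ab algebra_simps)
qed

text \<open>The total velocity drop across two shocks that meet at middle density
  \<open>r\<close>.\<close>

definition shock_strength :: "riemann_data \<Rightarrow> real \<Rightarrow> real" where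
  "shock_strength d r = (r - rho_minus d) * shock_slope (rho_minus d) r
     + (r - rho_plus d) * shock_slope (rho_plus d) r"

lemma eps1_eq_0_iff:
  assumes r: "0 < rho_minus d" "0 < rho_plus d" "rho_max d < r" and v: "vb_plus d < vb_minus d"
    and S: "0 < S_data d"
  shows "eps1 d r = 0 \<longleftrightarrow> shock_strength d r = vb_minus d - vb_plus d"
proof
  assume "eps1 d r = 0"
  with fan_equations_fan_parameters[OF r(1,3,2) v S]
  have "fan_equations d r (nu_minus d r) (nu_plus d r) (beta d r) 0" by simp
  from fan_equations_eps_zero(1,2)[OF this r v]
  show "shock_strength d r = vb_minus d - vb_plus d" by (simp add: shock_strength_def)
next
  assume U: "shock_strength d r = vb_minus d - vb_plus d"
  define a b where ab: "a = rho_minus d" "b = rho_plus d"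
  have pos: "0 < a" "0 < b" "a < r" "b < r" using r by (auto simp: ab rho_max_def)
  define s t where "s = shock_slope a r" and "t = shock_slope b r"
  have s: "a * r * s\<^sup>2 = r + a" "0 < s" and t: "b * r * t\<^sup>2 = r + b" "0 < t"
    using shock_slope_sq[of a r] shock_slope_sq[of b r] pos by (auto simp: s_def t_def)
  define \<beta> where "\<beta> = vb_minus d - (r - a) * s"
  have vm: "vb_minus d = \<beta> + (r - a) * s" by (simp add: \<beta>_def)
  have vp: "vb_plus d = \<beta> - (r - b) * t"
    using U by (simp add: \<beta>_def shock_strength_def ab s_def t_def)
  \<comment> \<open>The speeds are the middle velocity shifted by the relative shock speeds
    \<open>a * s\<close> and \<open>b * t\<close>.\<close>
  have "fan_equations d r (\<beta> - a * s) (\<beta> + b * t) \<beta> 0"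
    unfolding fan_equations_def pressure_def ab[symmetric] vm vp
  proof (intro conjI)
    have "0 < a * s" "0 < b * t" using pos s t by auto
    then show "\<beta> - a * s < \<beta> + b * t" by linarith
    show "(\<beta> - a * s) * (a * (\<beta> + (r - a) * s) - r * \<beta>)
        = a * (\<beta> + (r - a) * s)\<^sup>2 + a\<^sup>2 - r * (\<beta>\<^sup>2 + 0) - r\<^sup>2"
      using s(1) by algebra
    show "(\<beta> + b * t) * (b * (\<beta> - (r - b) * t) - r * \<beta>)
        = b * (\<beta> - (r - b) * t)\<^sup>2 + b\<^sup>2 - r * (\<beta>\<^sup>2 + 0) - r\<^sup>2"
      using t(1) by algebra
  qed (simp_all add: algebra_simps)
  from fan_parameters_eq(4)[OF this r(1,3)] show "eps1 d r = 0" .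
qed

text \<open>Squared, the term is \<open>(1 - a / s) * (s - a) * (s + a) / a\<close>, a product of
  nonnegative increasing factors.\<close>

lemma shock_term_less:
  assumes "0 < a" "a \<le> r" "r < r'"
  shows "(r - a) * shock_slope a r < (r' - a) * shock_slope a r'"
proof -
  have eq: "(s - a) * shock_slope a s = sqrt ((1 - a / s) * (s - a) * (s + a) / a)" if "a \<le> s" for s
  proof -
    have "sqrt ((s - a)\<^sup>2 * Y) = (s - a) * sqrt Y" for Y using that by (simp add: real_sqrt_mult)
    then have "(s - a) * shock_slope a s = sqrt ((s - a)\<^sup>2 * ((s + a) / (a * s)))"
      by (simp only: shock_slope_def)
    also have "(s - a)\<^sup>2 * ((s + a) / (a * s)) = (1 - a / s) * (s - a) * (s + a) / a"
      using that assms(1) by (simp add: field_simps power2_eq_square)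
    finally show ?thesis .
  qed
  have "a / r' < a / r" using assms by (intro divide_strict_left_mono) auto
  then have "(1 - a / r) * (r - a) * (r + a) < (1 - a / r') * (r' - a) * (r' + a)"
    using assms by (intro mult_strict_mono' mult_nonneg_nonneg) auto
  then show ?thesis using assms by (simp add: eq divide_strict_right_mono)
qed

text \<open>The total velocity drop is continuous and strictly increasing in the middle density, so
  it takes the value prescribed by the data exactly once.\<close>

lemma ex1_intermediate_density:
  assumes r: "0 < rho_minus d" "0 < rho_plus d" and v: "vb_plus d < vb_minus d" and S: "0 < S_data d"
  shows "\<exists>!r. is_intermediate_density d r"
proof -
  define a b U where abU: "a = rho_minus d" "b = rho_plus d" "U = vb_minus d - vb_plus d"
  have pos: "0 < a" "0 < b" "0 < U" using r v by (auto simp: abU)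
  have iff: "is_intermediate_density d r \<longleftrightarrow> rho_max d < r \<and> shock_strength d r = U" for r
    unfolding is_intermediate_density_def using eps1_eq_0_iff[OF r _ v S] by (auto simp: abU)
  have M: "rho_max d = max a b" by (simp add: rho_max_def abU)
  have mono: "shock_strength d x < shock_strength d y" if "max a b \<le> x" "x < y" for x y
    unfolding shock_strength_def abU[symmetric]
    using that pos by (intro add_strict_mono shock_term_less) auto
  \<comment> \<open>\<open>shock_slope a\<close> never falls below \<open>1 / sqrt a\<close>, so the
    lower shock alone achieves the drop \<open>U\<close> as soon as \<open>r - a\<close> is at least
    \<open>U * sqrt a\<close>.\<close>
  define K where "K = a + b + U * sqrt a"
  have K: "max a b \<le> K" "U * sqrt a \<le> K - a" using pos by (auto simp: K_def)
  have Sd: "(a - b)\<^sup>2 * (a + b) < U\<^sup>2 * (a * b)"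
    using S by (simp add: S_data_def pressure_def abU[symmetric] power2_eq_square algebra_simps)
  \<comment> \<open>At the larger of the two densities one shock degenerates, and the bound on the
    other is \<open>S_data d > 0\<close> after squaring.\<close>
  have low: "shock_strength d (max a b) < U"
  proof -
    have *: "(c - e) * shock_slope e c < U" if "e \<le> c" "(c - e)\<^sup>2 * (c + e) < U\<^sup>2 * (c * e)" "0 < e" for c e
    proof -
      have "(c - e) * shock_slope e c = sqrt ((c - e)\<^sup>2 * (c + e) / (e * c))"
        using that(1) by (simp add: shock_slope_def real_sqrt_mult real_sqrt_divide)
      also have "\<dots> < U" using that pos by (intro real_less_lsqrt) (auto simp: field_simps)
      finally show ?thesis .
    qed
    show ?thesis
    proof (cases "b \<le> a")
      case True
      then show ?thesis using *[of b a] Sd pos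
        by (simp add: shock_strength_def abU[symmetric] max_def)
    next
      case False
      then show ?thesis using *[of a b] Sd pos
        by (simp add: shock_strength_def abU[symmetric] max_def power2_commute add.commute mult.commute)
    qed
  qed
  have high: "U \<le> shock_strength d K"
  proof -
    have Kp: "0 < K" "a \<le> K" "b \<le> K" using K pos by auto
    have "1 / sqrt a = sqrt (1 / a)" by (simp add: real_sqrt_divide)
    also have "\<dots> \<le> shock_slope a K" unfolding shock_slope_def
      using Kp pos by (intro real_sqrt_le_mono) (simp add: field_simps)
    finally have sl: "1 / sqrt a \<le> shock_slope a K" .
    have "U = U * sqrt a * (1 / sqrt a)" using pos by simp
    also have "\<dots> \<le> (K - a) * shock_slope a K"
      using K sl pos Kp by (intro mult_mono) auto
    also have "\<dots> \<le> shock_strength d K"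
      using shock_slope_sq(2)[of b K] Kp pos by (simp add: shock_strength_def abU)
    finally show ?thesis .
  qed
  have "continuous_on {max a b..K} (shock_strength d)"
    unfolding shock_strength_def[abs_def] shock_slope_def abU[symmetric]
    using pos by (intro continuous_intros) auto
  then obtain r where "max a b \<le> r" "shock_strength d r = U"
    using IVT'[of "shock_strength d" "max a b" U K] low high K by auto
  moreover from this low have "max a b < r" by (cases "max a b = r") auto
  ultimately have "is_intermediate_density d r" by (simp add: iff M)
  moreover have "s = r" if "is_intermediate_density d s" "is_intermediate_density d r" for s r
    using that mono[of s r] mono[of r s] unfolding iff M by (cases s r rule: linorder_cases) auto
  ultimately show ?thesis by blast
qed

section \<open>Energy balance across the shocks\<close>

text \<open>In the frame of the shock the mass flux \<open>a * u = r * q\<close> is common to both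
  sides, and the energy defect is this flux times the jump of \<open>u^2 / 2 + 2 \<rho>\<close>.
  Eliminating the squares by Rankine-Hugoniot leaves a cube of the density jump, so the sign is that
  of \<open>\<beta> - \<nu>\<close>.\<close>

lemma energy_dissipation:
  fixes a r v \<beta> \<nu> :: real
  assumes pos: "0 < a" "a < r"
    and mass: "\<nu> * (a - r) = a * v - r * \<beta>"
    and mom: "\<nu> * (a * v - r * \<beta>) = a * v\<^sup>2 + a\<^sup>2 - r * \<beta>\<^sup>2 - r\<^sup>2"
  shows "((a * v\<^sup>2 / 2 + a * a) + a\<^sup>2) * v - ((r * \<beta>\<^sup>2 / 2 + r * r) + r\<^sup>2) * \<beta>
      - \<nu> * ((a * v\<^sup>2 / 2 + a * a) - (r * \<beta>\<^sup>2 / 2 + r * r)) = (\<beta> - \<nu>) * (r - a) ^ 3 / (2 * a)"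
    (is "?X = _")
proof -
  define u q where "u = v - \<nu>" and "q = \<beta> - \<nu>"
  have v: "v = u + \<nu>" "\<beta> = q + \<nu>" by (auto simp: u_def q_def)
  have 1: "a * u = r * q" using mass unfolding v by algebra
  have 2: "a * u\<^sup>2 + a\<^sup>2 = r * q\<^sup>2 + r\<^sup>2" using mass mom unfolding v by algebra
  have "(r - a) * (r * q\<^sup>2) = (r - a) * (a * (r + a))" using 1 2 by algebra
  then have q2: "r * q\<^sup>2 = a * (r + a)" using pos by simp
  define X where "X = ?X"
  have "2 * X = r * q * ((u\<^sup>2 - q\<^sup>2) + 4 * (a - r))"
    using 1 2 unfolding v X_def by (simp add: field_simps) algebra
  then have "2 * a\<^sup>2 * X = r * q * (a\<^sup>2 * (u\<^sup>2 - q\<^sup>2) + 4 * a\<^sup>2 * (a - r))" by algebra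
  also have "a\<^sup>2 * (u\<^sup>2 - q\<^sup>2) = q\<^sup>2 * (r\<^sup>2 - a\<^sup>2)" using 1 by algebra
  also have "r * q * (q\<^sup>2 * (r\<^sup>2 - a\<^sup>2) + 4 * a\<^sup>2 * (a - r))
      = q * (r - a) * ((r * q\<^sup>2) * (r + a) - 4 * a\<^sup>2 * r)" by algebra
  also have "\<dots> = a * (q * (r - a) ^ 3)" unfolding q2 by algebra
  finally have "a * (2 * a * X) = a * (q * (r - a) ^ 3)" by (simp only: power2_eq_square mult_ac)
  then have "2 * a * X = q * (r - a) ^ 3" using pos mult_left_cancel[of a "2 * a * X" "q * (r - a) ^ 3"] by blast
  then show ?thesis using pos unfolding X_def[symmetric] q_def by (simp add: field_simps)
qed

lemma norm_vector_0[simp]: "(norm (vector [0, x] :: real^2))\<^sup>2 = x\<^sup>2"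
  unfolding power2_norm_eq_inner by (simp add: inner_vec_def sum_2 power2_eq_square)

lemma two_shock_entropic:
  assumes f: "fan_equations d r \<nu> \<mu> \<beta> 0"
    and r: "0 < rho_minus d" "0 < rho_plus d" "rho_max d < r" and v: "vb_plus d < vb_minus d"
  shows "entropic_weak_solution (rho_init d) (v_init d)
    (step \<nu> \<mu> (rho_minus d) r (rho_plus d))
    (step \<nu> \<mu> (vector [0, vb_minus d]) (vector [0, \<beta>]) (vector [0, vb_plus d]))"
proof -
  define a b where ab: "a = rho_minus d" "b = rho_plus d"
  define vm vp where vmp: "vm = vb_minus d" "vp = vb_plus d"
  have pos: "0 < a" "0 < b" "a < r" "b < r" using r by (auto simp: ab rho_max_def)
  have lt: "\<nu> < \<mu>" using f by (simp add: fan_equations_def)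
  have rh: "\<nu> * (a - r) = a * vm - r * \<beta>" "\<mu> * (b - r) = b * vp - r * \<beta>"
    "\<nu> * (a * vm - r * \<beta>) = a * vm\<^sup>2 + a\<^sup>2 - r * \<beta>\<^sup>2 - r\<^sup>2"
    "\<mu> * (b * vp - r * \<beta>) = b * vp\<^sup>2 + b\<^sup>2 - r * \<beta>\<^sup>2 - r\<^sup>2"
    using f by (auto simp: fan_equations_def pressure_def ab vmp)
  note sg = fan_equations_eps_zero(3,4)[OF f r v]
  define \<rho> where "\<rho> = step \<nu> \<mu> a r b"
  define V :: "spacetime \<Rightarrow> real^2" where "V = step \<nu> \<mu> (vector [0, vm]) (vector [0, \<beta>]) (vector [0, vp])"
  have comb: "(\<lambda>z. g (\<rho> z) (V z))
      = step \<nu> \<mu> (g a (vector [0, vm])) (g r (vector [0, \<beta>])) (g b (vector [0, vp]))" for g :: "real \<Rightarrow> real^2 \<Rightarrow> 'x"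
    by (simp add: fun_eq_iff \<rho>_def V_def step_comp2)
  have init: "(\<lambda>x. g (rho_init d x) (v_init d x))
      = (\<lambda>x. if x $ 2 < 0 then g a (vector [0, vm]) else g b (vector [0, vp]))" for g :: "real \<Rightarrow> real^2 \<Rightarrow> real"
    by (simp add: fun_eq_iff rho_init_def v_init_def ab vmp)
  note pair = weak_pairing_step[OF _ lt]
  have meas: "\<rho> \<in> borel_measurable (lebesgue_on slab)" "V \<in> borel_measurable (lebesgue_on slab)"
    unfolding \<rho>_def V_def
    by (intro measurable_restrict_space1 measurable_completion; simp)+
  have weak: "weak_solution (rho_init d) (v_init d) \<rho> V"
    unfolding weak_solution_def
  proof (intro conjI allI impI meas)
    show "AE z in lebesgue. z \<in> slab \<longrightarrow> 0 \<le> \<rho> z" using pos by (auto simp: \<rho>_def step_def)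
    show "loc_integrable \<rho>" unfolding \<rho>_def by (rule loc_integrable_step)
    show "loc_integrable (\<lambda>z. \<rho> z *\<^sub>R V z)"
      unfolding comb[of "\<lambda>r v. r *\<^sub>R v"] by (rule loc_integrable_step)
    show "loc_integrable (\<lambda>z. momentum_flux i (\<rho> z) (V z))" for i
      unfolding comb[of "momentum_flux i"] by (rule loc_integrable_step)
    fix \<phi> :: "spacetime \<Rightarrow> real" assume \<phi>: "test_function \<phi>"
    show "weak_pairing \<rho> (\<lambda>z. \<rho> z *\<^sub>R V z) (rho_init d) \<phi> = 0"
      unfolding comb[of "\<lambda>r v. r *\<^sub>R v"] init[of "\<lambda>r v. r"]
      unfolding \<rho>_def pair[OF \<phi>]
      using rh(1,2) by (simp add: algebra_simps)
    show "weak_pairing (\<lambda>z. \<rho> z * V z $ i) (\<lambda>z. momentum_flux i (\<rho> z) (V z))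
        (\<lambda>x. rho_init d x * v_init d x $ i) \<phi> = 0" for i
    proof -
      have "(momentum_flux i a (vector [0, vm]) - momentum_flux i r (vector [0, \<beta>])) $ 2
          - \<nu> * (a * (vector [0, vm] :: real^2) $ i - r * (vector [0, \<beta>] :: real^2) $ i) = 0"
        "(momentum_flux i r (vector [0, \<beta>]) - momentum_flux i b (vector [0, vp])) $ 2
          - \<mu> * (r * (vector [0, \<beta>] :: real^2) $ i - b * (vector [0, vp] :: real^2) $ i) = 0"
        using exhaust_2[of i] rh(3,4)
        by (auto simp: momentum_flux_def axis_def pressure_def power2_eq_square algebra_simps)
      then show ?thesis
        unfolding comb[of "momentum_flux i"] comb[of "\<lambda>r v. r * v $ i"] init[of "\<lambda>r v. r * v $ i"] pair[OF \<phi>]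
        by simp
    qed
  qed
  have tot: "total_energy s (vector [0, x]) = s * x\<^sup>2 / 2 + s * s" for s x
    by (simp add: total_energy_def internal_energy_def)
  have flux: "energy_flux s (vector [0, x]) $ 2 = ((s * x\<^sup>2 / 2 + s * s) + s\<^sup>2) * x" for s x
    by (simp add: energy_flux_def tot pressure_def)
  have "entropic_weak_solution (rho_init d) (v_init d) \<rho> V"
    unfolding entropic_weak_solution_def
  proof (intro conjI allI impI weak)
    show "loc_integrable (\<lambda>z. total_energy (\<rho> z) (V z))"
      unfolding comb[of total_energy] by (rule loc_integrable_step)
    show "loc_integrable (\<lambda>z. energy_flux (\<rho> z) (V z))"
      unfolding comb[of energy_flux] by (rule loc_integrable_step)
    fix \<phi> :: "spacetime \<Rightarrow> real" assume \<phi>: "test_function \<phi> \<and> (\<forall>z. 0 \<le> \<phi> z)"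
    have G: "0 \<le> trace_functional \<phi> \<kappa>" for \<kappa>
      using \<phi> by (intro trace_functional_nonneg test_function_C1) auto
    \<comment> \<open>Both instances take the outer state first. At the upper shock the jump in the
      weak pairing runs the other way, so there a nonpositive dissipation term is the right
      sign.\<close>
    note dis = energy_dissipation[OF pos(1,3) rh(1,3)] energy_dissipation[OF pos(2,4) rh(2,4)]
    have "0 \<le> (\<beta> - \<nu>) * (r - a) ^ 3 / (2 * a)" using sg pos by simp
    moreover have "(\<beta> - \<mu>) * (r - b) ^ 3 / (2 * b) \<le> 0"
      using sg pos by (intro divide_nonpos_pos mult_nonpos_nonneg) auto
    ultimately show "0 \<le> weak_pairing (\<lambda>z. total_energy (\<rho> z) (V z)) (\<lambda>z. energy_flux (\<rho> z) (V z))
        (\<lambda>x. total_energy (rho_init d x) (v_init d x)) \<phi>"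
      unfolding comb[of total_energy] comb[of energy_flux] init[of total_energy] pair[OF conjunct1[OF \<phi>]]
        vector_minus_component tot flux dis[symmetric]
      by (intro add_nonneg_nonneg mult_nonneg_nonneg G) (simp_all add: algebra_simps)
  qed
  then show ?thesis by (simp add: \<rho>_def V_def ab vmp)
qed

section \<open>Comparison of the actions\<close>

lemma box_slab: "{0..T} \<times> space_box L3 l1 l2 \<subseteq> slab"
  by (auto simp: slab_def)

lemma box_measurable[measurable]: "{0..T::real} \<times> space_box L3 l1 l2 \<in> sets borel"
  unfolding space_box_def by (intro borel_closed closed_Times closed_atLeastAtMost closed_cbox)

lemma box_finite: "emeasure lborel ({0..T::real} \<times> space_box L3 l1 l2) < \<infinity>"
  unfolding space_box_def
  by (intro emeasure_bounded_finite bounded_Times bounded_cbox) (simp add: bounded_closed_interval)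

lemma lagrangian_box_measurable:
  assumes [measurable]: "\<rho> \<in> borel_measurable (lebesgue_on slab)" "v \<in> borel_measurable (lebesgue_on slab)"
  shows "(\<lambda>z. indicator ({0..T} \<times> space_box L3 l1 l2) z *\<^sub>R lagrangian (\<rho> z) (v z)) \<in> borel_measurable lebesgue"
proof -
  let ?Q = "{0..T} \<times> space_box L3 l1 l2"
  have "(\<lambda>z. lagrangian (\<rho> z) (v z)) \<in> borel_measurable (lebesgue_on slab)"
    unfolding lagrangian_def internal_energy_def by measurable
  then have 1: "(\<lambda>z. indicator slab z *\<^sub>R lagrangian (\<rho> z) (v z)) \<in> borel_measurable lebesgue"
    by (subst (asm) borel_measurable_restrict_space_iff) auto
  have 2: "indicator ?Q \<in> borel_measurable (lebesgue :: spacetime measure)"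
    by (intro borel_measurable_indicator) (use box_measurable in auto)
  have "(\<lambda>z. indicator ?Q z *\<^sub>R (indicator slab z *\<^sub>R lagrangian (\<rho> z) (v z))) \<in> borel_measurable lebesgue"
    by (rule borel_measurable_scaleR[OF 2 1])
  also have "(\<lambda>z. indicator ?Q z *\<^sub>R (indicator slab z *\<^sub>R lagrangian (\<rho> z) (v z)))
      = (\<lambda>z. indicator ?Q z *\<^sub>R lagrangian (\<rho> z) (v z))"
    by (auto simp: fun_eq_iff indicator_def slab_def)
  finally show ?thesis .
qed

text \<open>Only the Lagrangian has to be piecewise constant, not the fields; this admits
  oscillating velocities of constant modulus. The integral telescopes over half-spaces as in the
  weak pairing.\<close>

lemma action_step:
  assumes "\<rho> \<in> borel_measurable (lebesgue_on slab)" "v \<in> borel_measurable (lebesgue_on slab)"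
    and AE: "AE z in lebesgue. z \<in> slab \<longrightarrow> lagrangian (\<rho> z) (v z) = step \<nu> \<mu> Lm L1 Lp z"
    and lt: "\<nu> < \<mu>"
  shows "action L3 T l1 l2 \<rho> v
    = Lp * measure lborel ({0..T} \<times> space_box L3 l1 l2)
      + (L1 - Lp) * measure lborel (({0..T} \<times> space_box L3 l1 l2) \<inter> wedge \<mu>)
      + (Lm - L1) * measure lborel (({0..T} \<times> space_box L3 l1 l2) \<inter> wedge \<nu>)"
proof -
  define Q where "Q = {0..T} \<times> space_box L3 l1 l2"
  have Qm[measurable]: "Q \<in> sets borel" unfolding Q_def by measurable
  have Qs: "Q \<subseteq> slab" unfolding Q_def by (rule box_slab)
  have Qf: "emeasure lborel Q < \<infinity>" unfolding Q_def by (rule box_finite)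
  have fin: "emeasure lborel (Q \<inter> W) < \<infinity>" if "W \<in> sets borel" for W
    using Qf by (rule le_less_trans[rotated]) (use that in \<open>auto intro!: emeasure_mono\<close>)
  have m1: "(\<lambda>z. indicator Q z *\<^sub>R lagrangian (\<rho> z) (v z)) \<in> borel_measurable lebesgue"
    unfolding Q_def by (rule lagrangian_box_measurable[OF assms(1,2)])
  define h where "h z = Lp * indicator Q z + ((L1 - Lp) * indicator (Q \<inter> wedge \<mu>) z
      + (Lm - L1) * indicator (Q \<inter> wedge \<nu>) z)" for z
  have hb: "h \<in> borel_measurable borel" unfolding h_def[abs_def] by measurable
  have "action L3 T l1 l2 \<rho> v = (\<integral>z. indicator Q z *\<^sub>R lagrangian (\<rho> z) (v z) \<partial>lebesgue)"
    unfolding action_def space_time_box_eq set_lebesgue_integral_def Q_def ..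
  also have "\<dots> = integral\<^sup>L lebesgue h"
  proof (rule integral_cong_AE[OF m1])
    show "h \<in> borel_measurable lebesgue" using hb by (intro measurable_completion) simp
    have "AE z in lebesgue. fst (z :: spacetime) \<noteq> 0" "AE z in lebesgue. snd z $ 2 \<noteq> \<nu> * fst (z :: spacetime)"
      using AE_time_nonzero AE_shock_line by (auto simp: AE_completion_iff)
    then show "AE z in lebesgue. indicator Q z *\<^sub>R lagrangian (\<rho> z) (v z) = h z"
      using AE
    proof eventually_elim
      case (elim z)
      show ?case
      proof (cases "z \<in> Q")
        case True
        then have t: "0 < fst z" using elim(1) Qs by (auto simp: slab_def)
        then have "\<nu> * fst z < \<mu> * fst z" using lt by simp
        then have "snd z $ 2 < \<mu> * fst z" if "snd z $ 2 < \<nu> * fst z" using that by linarith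
        moreover have "lagrangian (\<rho> z) (v z) = step \<nu> \<mu> Lm L1 Lp z" using elim(3) True Qs by auto
        ultimately show ?thesis using True t elim(2)
          by (auto simp: h_def step_def wedge_def indicator_def)
      qed (simp add: h_def)
    qed
  qed
  also have "\<dots> = integral\<^sup>L lborel h" using hb by (intro integral_completion) simp
  also have "\<dots> = Lp * measure lborel Q + ((L1 - Lp) * measure lborel (Q \<inter> wedge \<mu>)
      + (Lm - L1) * measure lborel (Q \<inter> wedge \<nu>))"
  proof -
    have i: "integrable lborel (\<lambda>z. c * indicat_real (Q \<inter> W) z)" if "W \<in> sets borel" for c W
      using fin[OF that] that by (intro integrable_mult_right integrable_real_indicator) auto
    from i[of UNIV] have i0: "integrable lborel (\<lambda>z. c * indicat_real Q z)" for c by simp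
    show ?thesis unfolding h_def[abs_def]
      by (subst Bochner_Integration.integral_add Bochner_Integration.integral_add,
          (intro i0 i Bochner_Integration.integrable_add wedge_measurable)+)+ simp
  qed
  finally show ?thesis unfolding Q_def by simp
qed

section \<open>Lagrangians and far fields of the competitors\<close>

lemma two_shock_eq_step:
  "two_shock_rho d = step (nu_minus d (rho_m d)) (nu_plus d (rho_m d)) (rho_minus d) (rho_m d) (rho_plus d)"
  "two_shock_v d = step (nu_minus d (rho_m d)) (nu_plus d (rho_m d))
     (vector [0, vb_minus d]) (vector [0, v_m d]) (vector [0, vb_plus d])"
  by (auto simp: fun_eq_iff two_shock_rho_def two_shock_v_def step_def P_minus_def P_1_def)

lemma lagrangian_vector_0: "lagrangian r (vector [0, x]) = r * x\<^sup>2 / 2 - r\<^sup>2"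
  unfolding lagrangian_def internal_energy_def norm_vector_0 by (simp add: power2_eq_square)

text \<open>Take traces: the trace of \<open>outer x x\<close> is the squared norm, \<open>u\<close>
  is trace-free by assumption, and \<open>u1_fan\<close> by the choice of
  \<open>C_fan\<close>.\<close>

lemma norm_sq_eq_C_fan:
  assumes eq: "outer (v1_fan d r + w) (v1_fan d r + w) - (u1_fan d r \<epsilon>2 + u) = mat (C_fan d r \<epsilon>2 / 2)"
    and tr: "trace u = 0"
  shows "(norm (v1_fan d r + w))\<^sup>2 = C_fan d r \<epsilon>2"
proof -
  let ?C = "C_fan d r \<epsilon>2"
  have outer: "trace (outer x x) = (norm x)\<^sup>2" for x
    unfolding power2_norm_eq_inner by (simp add: trace_def outer_def inner_vec_def)
  have mat: "trace (mat c :: real^2^2) = 2 * c" for c :: real by (simp add: trace_def mat_def sum_2)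
  have diag: "trace (diag2 x y) = x + y" for x y by (simp add: trace_def diag2_def sum_2)
  have u1: "trace (u1_fan d r \<epsilon>2) = 0"
    unfolding u1_fan_def trace_sub outer mat diag by (simp add: v1_fan_def C_fan_def field_simps)
  have "(norm (v1_fan d r + w))\<^sup>2 - (trace (u1_fan d r \<epsilon>2) + trace u) = ?C"
    using arg_cong[OF eq, of trace] by (simp add: trace_sub trace_add outer mat)
  then show ?thesis using u1 tr by simp
qed

lemma convex_integration_lagrangian:
  assumes c: "convex_integration_solution d r \<epsilon>2 \<rho> v" and lt: "nu_minus d r < nu_plus d r"
  shows "AE z in lebesgue. z \<in> slab \<longrightarrow> lagrangian (\<rho> z) (v z) =
    step (nu_minus d r) (nu_plus d r) (rho_minus d * (vb_minus d)\<^sup>2 / 2 - (rho_minus d)\<^sup>2)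
      (r * C_fan d r \<epsilon>2 / 2 - r\<^sup>2) (rho_plus d * (vb_plus d)\<^sup>2 / 2 - (rho_plus d)\<^sup>2) z"
proof -
  have lines: "AE z in lebesgue. fst (z :: spacetime) \<noteq> 0"
    "AE z in lebesgue. snd z $ 2 \<noteq> nu_minus d r * fst (z :: spacetime)"
    "AE z in lebesgue. snd z $ 2 \<noteq> nu_plus d r * fst (z :: spacetime)"
    using AE_time_nonzero AE_shock_line by (auto simp: AE_completion_iff)
  obtain w :: "spacetime \<Rightarrow> real^2" and u :: "spacetime \<Rightarrow> real^2^2" where
    tr: "AE z in lebesgue. transpose (u z) = u z \<and> trace (u z) = 0"
    and st: "AE z in lebesgue. z \<in> P_1 d r \<longrightarrow> \<rho> z = r \<and> v z = v1_fan d r + w z"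
    and eq: "AE z in lebesgue. z \<in> P_1 d r \<longrightarrow>
           outer (v1_fan d r + w z) (v1_fan d r + w z) - (u1_fan d r \<epsilon>2 + u z) = mat (C_fan d r \<epsilon>2 / 2)"
    using c unfolding convex_integration_solution_def by blast
  have "AE z in lebesgue. z \<in> P_minus d r \<longrightarrow> \<rho> z = rho_minus d \<and> v z = vector [0, vb_minus d]"
    "AE z in lebesgue. z \<in> P_plus d r \<longrightarrow> \<rho> z = rho_plus d \<and> v z = vector [0, vb_plus d]"
    using c unfolding convex_integration_solution_def by blast+
  then show ?thesis using tr st eq lines
  proof eventually_elim
    case (elim z)
    show ?case
    proof
      assume "z \<in> slab"
      then have t: "0 < fst z" using elim(6) by (auto simp: slab_def)
      then have "nu_minus d r * fst z < nu_plus d r * fst z" using lt by simp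
      then consider "z \<in> P_minus d r" "snd z $ 2 < nu_minus d r * fst z"
        | "z \<in> P_1 d r" "nu_minus d r * fst z < snd z $ 2" "snd z $ 2 < nu_plus d r * fst z"
        | "z \<in> P_plus d r" "nu_minus d r * fst z < snd z $ 2" "nu_plus d r * fst z < snd z $ 2"
        using t elim(7,8) unfolding P_minus_def P_1_def P_plus_def case_prod_unfold mem_Collect_eq
        by linarith
      then show "lagrangian (\<rho> z) (v z) =
        step (nu_minus d r) (nu_plus d r) (rho_minus d * (vb_minus d)\<^sup>2 / 2 - (rho_minus d)\<^sup>2)
          (r * C_fan d r \<epsilon>2 / 2 - r\<^sup>2) (rho_plus d * (vb_plus d)\<^sup>2 / 2 - (rho_plus d)\<^sup>2) z"
      proof cases
        case 1
        then show ?thesis using elim(1) t by (simp add: step_def lagrangian_vector_0)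
      next
        case 2
        then have "(norm (v z))\<^sup>2 = C_fan d r \<epsilon>2" "\<rho> z = r"
          using elim(3-5) norm_sq_eq_C_fan by auto
        then show ?thesis using 2 t by (simp add: step_def lagrangian_def internal_energy_def power2_eq_square)
      next
        case 3
        then show ?thesis using elim(2) t by (simp add: step_def lagrangian_vector_0)
      qed
    qed
  qed
qed

text \<open>Admissibility compares only solutions with equal far fields; this makes the two shock
  solution a legitimate competitor. Up to time \<open>T\<close> all interfaces stay in a bounded
  range of the second coordinate.\<close>

lemma same_boundary_data_convex_two_shock:
  assumes c: "convex_integration_solution d r \<epsilon>2 \<rho> v" and T: "0 < T"
    and lt: "nu_minus d (rho_m d) < nu_plus d (rho_m d)"
  shows "same_boundary_data T \<rho> v (two_shock_rho d) (two_shock_v d)"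
proof -
  \<comment> \<open>Strictly larger than the modulus of each of the four speeds, thanks to the
    \<open>+ 1\<close>.\<close>
  let ?N = "\<bar>nu_minus d r\<bar> + \<bar>nu_plus d r\<bar> + \<bar>nu_minus d (rho_m d)\<bar> + \<bar>nu_plus d (rho_m d)\<bar> + 1"
  have "AE z in lebesgue. fst (z :: spacetime) \<noteq> 0"
    using AE_time_nonzero by (auto simp: AE_completion_iff)
  moreover have "AE z in lebesgue. z \<in> P_minus d r \<longrightarrow> \<rho> z = rho_minus d \<and> v z = vector [0, vb_minus d]"
    "AE z in lebesgue. z \<in> P_plus d r \<longrightarrow> \<rho> z = rho_plus d \<and> v z = vector [0, vb_plus d]"
    using c unfolding convex_integration_solution_def by blast+
  ultimately have "AE z in lebesgue. fst z \<in> {0..T} \<and> T * ?N \<le> \<bar>snd z $ 2\<bar> \<longrightarrow>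
      \<rho> z = two_shock_rho d z \<and> v z = two_shock_v d z"
  proof eventually_elim
    case (elim z)
    show ?case
    proof
      assume z: "fst z \<in> {0..T} \<and> T * ?N \<le> \<bar>snd z $ 2\<bar>"
      then have t: "0 < fst z" "fst z \<le> T" using elim(1) by auto
      have b: "\<bar>\<kappa> * fst z\<bar> < \<bar>snd z $ 2\<bar>" if "\<bar>\<kappa>\<bar> < ?N" for \<kappa>
      proof -
        have "\<bar>\<kappa> * fst z\<bar> = \<bar>\<kappa>\<bar> * fst z" using t by (simp add: abs_mult)
        also have "\<dots> \<le> \<bar>\<kappa>\<bar> * T" using t by (intro mult_left_mono) auto
        also have "\<dots> < ?N * T" using that T by simp
        finally show ?thesis using z by (simp add: mult.commute)
      qed
      have bb: "\<bar>nu_minus d r * fst z\<bar> < \<bar>snd z $ 2\<bar>" "\<bar>nu_plus d r * fst z\<bar> < \<bar>snd z $ 2\<bar>"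
        "\<bar>nu_minus d (rho_m d) * fst z\<bar> < \<bar>snd z $ 2\<bar>" "\<bar>nu_plus d (rho_m d) * fst z\<bar> < \<bar>snd z $ 2\<bar>"
        by (rule b; linarith)+
      show "\<rho> z = two_shock_rho d z \<and> v z = two_shock_v d z"
      proof (cases "snd z $ 2 < 0")
        case True
        then have "z \<in> P_minus d r" "z \<in> P_minus d (rho_m d)"
          using bb t by (auto simp: P_minus_def case_prod_unfold)
        then show ?thesis using elim by (simp add: two_shock_rho_def two_shock_v_def)
      next
        case False
        then have "z \<in> P_plus d r" "z \<notin> P_minus d (rho_m d)" "z \<notin> P_1 d (rho_m d)"
          using bb t by (auto simp: P_minus_def P_plus_def P_1_def case_prod_unfold)
        then show ?thesis using elim by (simp add: two_shock_rho_def two_shock_v_def)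
      qed
    qed
  qed
  then show ?thesis unfolding same_boundary_data_def by blast
qed

lemma two_shock_action_less:
  assumes pos: "0 < rho_minus d" "0 < rho_plus d" and v: "vb_plus d < vb_minus d" and S: "0 < S_data d"
    and m: "is_intermediate_density d (rho_m d)"
    and star: "rho_max d < \<rho>star" "\<rho>star \<le> r" "r < rho_m d" and \<epsilon>2: "0 < \<epsilon>2"
    and box: "adapted_box d {\<rho>star..rho_m d} L3 T l1 l2"
    and c: "convex_integration_solution d r \<epsilon>2 \<rho> v'"
  shows "action L3 T l1 l2 (two_shock_rho d) (two_shock_v d) < action L3 T l1 l2 \<rho> v'"
proof -
  define m1 n1 \<beta>1 e1 where fan1_def: "m1 = nu_minus d r" "n1 = nu_plus d r" "\<beta>1 = beta d r" "e1 = eps1 d r"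
  define m2 n2 \<beta>2 where fan2_def: "m2 = nu_minus d (rho_m d)" "n2 = nu_plus d (rho_m d)" "\<beta>2 = beta d (rho_m d)"
  have fan: "fan_equations d s (nu_minus d s) (nu_plus d s) (beta d s) (eps1 d s)" if "rho_max d < s" for s
    using fan_equations_fan_parameters[OF pos(1) that pos(2) v S] .
  have f1: "fan_equations d r m1 n1 \<beta>1 e1" using fan[of r] star by (simp add: fan1_def)
  have f2: "fan_equations d (rho_m d) m2 n2 \<beta>2 0"
    using fan[of "rho_m d"] m by (simp add: fan2_def is_intermediate_density_def)
  have lt: "m1 < n1" "m2 < n2" using f1 f2 unfolding fan_equations_def by blast+
  have L3: "0 < L3" and T: "0 < T" and l: "l1 < l2"
    and bl: "l1 < T * (INF s\<in>{\<rho>star..rho_m d}. nu_minus d s)" "T * (SUP s\<in>{\<rho>star..rho_m d}. nu_plus d s) < l2"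
    using box by (auto simp: adapted_box_def)
  have nu: "l1 < T * nu_minus d s" "T * nu_plus d s < l2" if "s \<in> {\<rho>star..rho_m d}" for s
  proof -
    \<comment> \<open>\<open>INF\<close> and \<open>SUP\<close> bound the single speeds only for
      bounded families; by nesting, the speeds at \<open>\<rho>star\<close> are bounds.\<close>
    have mono: "nu_minus d \<rho>star \<le> nu_minus d x" "nu_plus d x \<le> nu_plus d \<rho>star"
      if "x \<in> {\<rho>star..rho_m d}" for x
      by (rule fan_equations_mono[OF fan fan pos(1) star(1)]; use that star(1) in auto)+
    have "bdd_below (nu_minus d ` {\<rho>star..rho_m d})"
      using mono(1) by (intro bdd_belowI2)
    then have "(INF s\<in>{\<rho>star..rho_m d}. nu_minus d s) \<le> nu_minus d s" using that by (rule cINF_lower)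
    then have "T * (INF s\<in>{\<rho>star..rho_m d}. nu_minus d s) \<le> T * nu_minus d s" using T by simp
    with bl(1) show "l1 < T * nu_minus d s" by linarith
    have "bdd_above (nu_plus d ` {\<rho>star..rho_m d})"
      using mono(2) by (intro bdd_aboveI2)
    then have "nu_plus d s \<le> (SUP s\<in>{\<rho>star..rho_m d}. nu_plus d s)" using that by (intro cSUP_upper)
    then have "T * nu_plus d s \<le> T * (SUP s\<in>{\<rho>star..rho_m d}. nu_plus d s)" using T by simp
    with bl(2) show "T * nu_plus d s < l2" by linarith
  qed
  have in_box: "l1 < T * x \<and> T * x < l2" if "x \<in> {m1, n1, m2, n2}" for x
  proof -
    have "T * m1 < T * n1" "T * m2 < T * n2" using lt T by auto
    moreover have "l1 < T * m1" "T * n1 < l2" "l1 < T * m2" "T * n2 < l2"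
      using nu[of r] nu[of "rho_m d"] star by (auto simp: fan1_def fan2_def)
    ultimately have "l1 < T * m1 \<and> T * m1 < l2" "l1 < T * n1 \<and> T * n1 < l2"
      "l1 < T * m2 \<and> T * m2 < l2" "l1 < T * n2 \<and> T * n2 < l2" by linarith+
    then show ?thesis using that by blast
  qed
  obtain c0 k where k: "k = 0 \<or> 0 < k \<and> (\<forall>x y. l1 < T * x \<and> T * x < l2 \<and> l1 < T * y \<and> T * y < l2 \<longrightarrow> k \<le> x * y)"
    and vol: "\<And>\<nu>. l1 < T * \<nu> \<Longrightarrow> T * \<nu> < l2 \<Longrightarrow>
      measure lborel (({0..T} \<times> space_box L3 l1 l2) \<inter> wedge \<nu>) = c0 + L3 * T\<^sup>2 * (\<nu> + k / \<nu>)"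
    by (rule box_wedge_volume[OF L3 T l], rule that)
  define V where "V x = measure lborel (({0..T} \<times> space_box L3 l1 l2) \<inter> wedge x)" for x
  define V0 where "V0 = measure lborel ({0..T} \<times> space_box L3 l1 l2)"
  define \<phi> where "\<phi> x = x + k / x" for x
  define Lm where "Lm = rho_minus d * (vb_minus d)\<^sup>2 / 2 - (rho_minus d)\<^sup>2"
  define Lp where "Lp = rho_plus d * (vb_plus d)\<^sup>2 / 2 - (rho_plus d)\<^sup>2"
  define M1 where "M1 = r * (\<beta>1\<^sup>2 + e1) / 2 - r\<^sup>2"
  define M2 where "M2 = rho_m d * (\<beta>2\<^sup>2 + 0) / 2 - (rho_m d)\<^sup>2"
  have vol': "V x = c0 + L3 * T\<^sup>2 * \<phi> x" if "x \<in> {m1, n1, m2, n2}" for x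
    using vol in_box[OF that] by (simp add: V_def \<phi>_def)
  have kk: "k = 0 \<or> 0 < k \<and> (\<forall>x\<in>{m1, n1, m2, n2}. \<forall>y\<in>{m1, n1, m2, n2}. k \<le> x * y)"
    using k in_box by blast
  have less: "(Lm - M2) * \<phi> m2 + (M2 - Lp) * \<phi> n2 < (Lm - M1) * \<phi> m1 + (M1 - Lp) * \<phi> n1"
    unfolding Lm_def Lp_def M1_def M2_def \<phi>_def
    by (rule fan_action_decreasing[OF f1 f2 pos(1) _ star(3) kk]) (use star in simp)
  have ent: "entropic_weak_solution (rho_init d) (v_init d) \<rho> v'"
    using c by (simp add: convex_integration_solution_def)
  have "action L3 T l1 l2 (two_shock_rho d) (two_shock_v d) = Lp * V0 + (M2 - Lp) * V n2 + (Lm - M2) * V m2"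
    unfolding V_def V0_def
  proof (rule action_step[OF _ _ _ lt(2)])
    show "two_shock_rho d \<in> borel_measurable (lebesgue_on slab)" "two_shock_v d \<in> borel_measurable (lebesgue_on slab)"
      unfolding two_shock_eq_step by (intro measurable_restrict_space1 measurable_completion; simp)+
    show "AE z in lebesgue. z \<in> slab \<longrightarrow> lagrangian (two_shock_rho d z) (two_shock_v d z) = step m2 n2 Lm M2 Lp z"
      unfolding two_shock_eq_step step_comp2 lagrangian_vector_0 Lm_def M2_def Lp_def
      by (simp add: fan2_def v_m_def)
  qed
  \<comment> \<open>The middle Lagrangian drops out of the coefficient of \<open>c0\<close>, so the
    bracket is common to both solutions.\<close>
  also have "\<dots> = (Lp * V0 + (Lm - Lp) * c0) + L3 * T\<^sup>2 * ((Lm - M2) * \<phi> m2 + (M2 - Lp) * \<phi> n2)"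
    by (simp add: vol' algebra_simps)
  also have "\<dots> < (Lp * V0 + (Lm - Lp) * c0) + L3 * T\<^sup>2 * ((Lm - M1) * \<phi> m1 + (M1 - Lp) * \<phi> n1)"
    using less L3 T by simp
  also have "\<dots> = Lp * V0 + (M1 - Lp) * V n1 + (Lm - M1) * V m1"
    by (simp add: vol' algebra_simps)
  \<comment> \<open>The parameter \<epsilon>2 raises the middle Lagrangian by
    \<open>r * \<epsilon>2 / 2\<close>, which is multiplied by the volume between the
    interfaces.\<close>
  also have "\<dots> \<le> Lp * V0 + (M1 + r * \<epsilon>2 / 2 - Lp) * V n1 + (Lm - (M1 + r * \<epsilon>2 / 2)) * V m1"
  proof -
    have "V m1 \<le> V n1" unfolding V_def
    proof (rule measure_mono_fmeasurable)
      show "({0..T} \<times> space_box L3 l1 l2) \<inter> wedge m1 \<subseteq> ({0..T} \<times> space_box L3 l1 l2) \<inter> wedge n1"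
      proof
        fix z assume z: "z \<in> ({0..T} \<times> space_box L3 l1 l2) \<inter> wedge m1"
        then have "m1 * fst z \<le> n1 * fst z" using lt by (intro mult_right_mono) auto
        with z show "z \<in> ({0..T} \<times> space_box L3 l1 l2) \<inter> wedge n1" by (auto simp: wedge_def)
      qed
      have "W \<in> sets borel \<Longrightarrow> ({0..T} \<times> space_box L3 l1 l2) \<inter> W \<in> sets lborel" for W
        using sets.Int[OF box_measurable] by simp
      note this[OF wedge_measurable]
      then show "({0..T} \<times> space_box L3 l1 l2) \<inter> wedge m1 \<in> sets lborel"
        "({0..T} \<times> space_box L3 l1 l2) \<inter> wedge n1 \<in> fmeasurable lborel"
        using box_finite[of T L3 l1 l2] box_measurable[of T L3 l1 l2]
        by (blast, intro fmeasurableI2[OF fmeasurableI Int_lower1]) simp_all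
    qed
    moreover have "0 < r" using star pos unfolding rho_max_def by linarith
    ultimately have "0 \<le> r * \<epsilon>2 / 2 * (V n1 - V m1)" using \<epsilon>2 by simp
    moreover have "Lp * V0 + (M1 + x - Lp) * V n1 + (Lm - (M1 + x)) * V m1
        = Lp * V0 + (M1 - Lp) * V n1 + (Lm - M1) * V m1 + x * (V n1 - V m1)" for x by algebra
    ultimately show ?thesis by simp
  qed
  also have "\<dots> = action L3 T l1 l2 \<rho> v'"
    unfolding V_def V0_def
  proof (rule action_step[OF _ _ _ lt(1), symmetric])
    show "\<rho> \<in> borel_measurable (lebesgue_on slab)" "v' \<in> borel_measurable (lebesgue_on slab)"
      using ent by (auto simp: entropic_weak_solution_def weak_solution_def)
    have "r * C_fan d r \<epsilon>2 / 2 - r\<^sup>2 = M1 + r * \<epsilon>2 / 2"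
      by (simp add: C_fan_def M1_def fan1_def algebra_simps add_divide_distrib)
    then show "AE z in lebesgue. z \<in> slab \<longrightarrow> lagrangian (\<rho> z) (v' z) = step m1 n1 Lm (M1 + r * \<epsilon>2 / 2) Lp z"
      using convex_integration_lagrangian[OF c] lt(1) by (simp add: fan1_def Lm_def Lp_def)
  qed
  finally show ?thesis .
qed

text \<open>Carries the comparison in (3) over to representatives that agree with the two shock
  fields only almost everywhere.\<close>

lemma action_same_solution:
  assumes s: "same_solution \<rho> v \<rho>' v'"
    and m: "\<rho> \<in> borel_measurable (lebesgue_on slab)" "v \<in> borel_measurable (lebesgue_on slab)"
      "\<rho>' \<in> borel_measurable (lebesgue_on slab)" "v' \<in> borel_measurable (lebesgue_on slab)"
  shows "action L3 T l1 l2 \<rho> v = action L3 T l1 l2 \<rho>' v'"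
  unfolding action_def space_time_box_eq set_lebesgue_integral_def
proof (rule integral_cong_AE[OF lagrangian_box_measurable[OF m(1,2)] lagrangian_box_measurable[OF m(3,4)]])
  show "AE z in lebesgue. indicator ({0..T} \<times> space_box L3 l1 l2) z *\<^sub>R lagrangian (\<rho> z) (v z)
      = indicator ({0..T} \<times> space_box L3 l1 l2) z *\<^sub>R lagrangian (\<rho>' z) (v' z)"
    using s[unfolded same_solution_def] by eventually_elim (use box_slab[of T L3 l1 l2] in \<open>auto simp: indicator_def\<close>)
qed

theorem theorem6:
  fixes d :: riemann_data and \<rho>star L3 T l1 l2 :: real
  assumes "0 < rho_minus d" and "0 < rho_plus d"
    and "vb_plus d < vb_minus d"
    and "0 < S_data d"
    and "rho_max d < \<rho>star" and "\<rho>star < rho_m d"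
    and "adapted_box d {\<rho>star..rho_m d} L3 T l1 l2"
  shows "((\<exists>!r. is_intermediate_density d r) \<and>
     entropic_weak_solution (rho_init d) (v_init d) (two_shock_rho d) (two_shock_v d)) \<and>
    (\<forall>\<epsilon>2>0. \<forall>\<rho>1\<in>{\<rho>star..<rho_m d}. \<forall>\<rho> v. convex_integration_solution d \<rho>1 \<epsilon>2 \<rho> v \<longrightarrow>
       action L3 T l1 l2 (two_shock_rho d) (two_shock_v d) < action L3 T l1 l2 \<rho> v) \<and>
    (\<forall>\<epsilon>2>0. \<forall>\<rho>1\<in>{\<rho>star..<rho_m d}. \<forall>\<rho> v. convex_integration_solution d \<rho>1 \<epsilon>2 \<rho> v \<longrightarrow>
       \<not> laap_admissible L3 T l1 l2 (rho_init d) (v_init d) \<rho> v) \<and>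
    ((\<forall>\<rho> v. entropic_weak_solution (rho_init d) (v_init d) \<rho> v \<longrightarrow>
        same_solution \<rho> v (two_shock_rho d) (two_shock_v d) \<or>
        (\<exists>\<rho>1\<in>{\<rho>star..<rho_m d}. \<exists>\<epsilon>2>0. convex_integration_solution d \<rho>1 \<epsilon>2 \<rho> v)) \<longrightarrow>
     laap_admissible L3 T l1 l2 (rho_init d) (v_init d) (two_shock_rho d) (two_shock_v d) \<and>
     (\<forall>\<rho> v. laap_admissible L3 T l1 l2 (rho_init d) (v_init d) \<rho> v \<longrightarrow>
        same_solution \<rho> v (two_shock_rho d) (two_shock_v d)))"
proof -
  have ex1: "\<exists>!r. is_intermediate_density d r"
    by (rule ex1_intermediate_density[OF assms(1-4)])
  then have m: "is_intermediate_density d (rho_m d)"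
    unfolding rho_m_def by (rule theI')
  then have rm: "rho_max d < rho_m d" "eps1 d (rho_m d) = 0" by (auto simp: is_intermediate_density_def)
  have fan: "fan_equations d (rho_m d) (nu_minus d (rho_m d)) (nu_plus d (rho_m d)) (v_m d) 0"
    using fan_equations_fan_parameters[OF assms(1) rm(1) assms(2-4)] rm(2) by (simp add: v_m_def)
  have ent: "entropic_weak_solution (rho_init d) (v_init d) (two_shock_rho d) (two_shock_v d)"
    unfolding two_shock_eq_step by (rule two_shock_entropic[OF fan assms(1,2) rm(1) assms(3)])
  have T: "0 < T" using assms(7) by (simp add: adapted_box_def)
  have less: "action L3 T l1 l2 (two_shock_rho d) (two_shock_v d) < action L3 T l1 l2 \<rho> v"
    if "0 < \<epsilon>2" "\<rho>1 \<in> {\<rho>star..<rho_m d}" "convex_integration_solution d \<rho>1 \<epsilon>2 \<rho> v" for \<epsilon>2 \<rho>1 \<rho> v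
    using two_shock_action_less[OF assms(1-4) m assms(5) _ _ that(1) assms(7) that(3)] that(2) by simp
  have not_adm: "\<not> laap_admissible L3 T l1 l2 (rho_init d) (v_init d) \<rho> v"
    if "0 < \<epsilon>2" "\<rho>1 \<in> {\<rho>star..<rho_m d}" "convex_integration_solution d \<rho>1 \<epsilon>2 \<rho> v" for \<epsilon>2 \<rho>1 \<rho> v
  proof -
    have "same_boundary_data T \<rho> v (two_shock_rho d) (two_shock_v d)"
      using fan unfolding fan_equations_def by (intro same_boundary_data_convex_two_shock[OF that(3) T]) blast
    then show ?thesis using less[OF that] ent unfolding laap_admissible_def by (meson not_le)
  qed
  have adm: "laap_admissible L3 T l1 l2 (rho_init d) (v_init d) (two_shock_rho d) (two_shock_v d)"
    and uniq: "laap_admissible L3 T l1 l2 (rho_init d) (v_init d) \<rho> v \<Longrightarrow>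
      same_solution \<rho> v (two_shock_rho d) (two_shock_v d)"
    if only: "\<forall>\<rho> v. entropic_weak_solution (rho_init d) (v_init d) \<rho> v \<longrightarrow>
        same_solution \<rho> v (two_shock_rho d) (two_shock_v d) \<or>
        (\<exists>\<rho>1\<in>{\<rho>star..<rho_m d}. \<exists>\<epsilon>2>0. convex_integration_solution d \<rho>1 \<epsilon>2 \<rho> v)" for \<rho> v
  proof -
    have "action L3 T l1 l2 (two_shock_rho d) (two_shock_v d) \<le> action L3 T l1 l2 \<rho>' v'"
      if e: "entropic_weak_solution (rho_init d) (v_init d) \<rho>' v'" for \<rho>' v'
    proof -
      consider "same_solution \<rho>' v' (two_shock_rho d) (two_shock_v d)"
        | \<rho>1 \<epsilon>2 where "\<rho>1 \<in> {\<rho>star..<rho_m d}" "0 < \<epsilon>2" "convex_integration_solution d \<rho>1 \<epsilon>2 \<rho>' v'"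
        using only e by blast
      then show ?thesis
      proof cases
        case 1
        then show ?thesis using action_same_solution[OF 1] e ent
          by (simp add: entropic_weak_solution_def weak_solution_def)
      next
        case 2
        then show ?thesis using less by (simp add: less_imp_le)
      qed
    qed
    then show "laap_admissible L3 T l1 l2 (rho_init d) (v_init d) (two_shock_rho d) (two_shock_v d)"
      using ent unfolding laap_admissible_def by blast
    show "same_solution \<rho> v (two_shock_rho d) (two_shock_v d)"
      if a: "laap_admissible L3 T l1 l2 (rho_init d) (v_init d) \<rho> v"
      using only a not_adm unfolding laap_admissible_def[of _ _ _ _ _ _ \<rho> v] by (metis a)
  qed
  show ?thesis
    using ex1 ent less not_adm adm uniq by blast
qed

end
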